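(* The group $\widetilde{\mathrm{Sp}}_{\psi,S}^R(W)$ is a central extension of $\mathrm{Sp}(W)$ by $R^\times$ and fits into the exact sequence $$1\to R^\times\overset{i_S}{\to}\widetilde{\mathrm{Sp}}_{\psi,S}^R(W)\overset{p_S}{\to}\mathrm{Sp}(W)\to1,$$ where $i_S:\lambda\mapsto(\mathrm{Id}_W,\lambda\,\mathrm{Id}_S)$. For two models $S$ and $S'$ of $\rho_\psi$, and for every isomorphism of representations $\phi:S\to S'$, the isomorphism of central extensions $$\widetilde{\mathrm{Sp}}_{\psi,S}^R(W)\to\widetilde{\mathrm{Sp}}_{\psi,S'}^R(W),\qquad(g,M)\mapsto(g,\phi M\phi^{-1})$$ does not depend on the choice of $\phi$; denote it $\Phi_{S,S'}$. Except in the case $F=\mathbb F_3$ and $\dim_FW=2$, there exists a unique isomorphism of central extensions between $\widetilde{\mathrm{Sp}}_{\psi,S}^R(W)$ and $\widetilde{\mathrm{Sp}}_{\psi,S'}^R(W)$, and it is given by $\Phi_{S,S'}$.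
   Context: $F$ is a field which is either finite of characteristic $p$ or non-archimedean local of residual characteristic $p$, of characteristic different from $2$; $(W,\langle\,,\rangle)$ is a finite-dimensional symplectic space over $F$; $R$ is a field with a fixed non-trivial smooth character $\psi:F\to R^\times$ (so $\mathrm{char}\,R\neq p$). Heisenberg group: $H=W\times F$ with $(w,t)(w',t')=(w+w',t+t'+\tfrac12\langle w,w'\rangle)$, centre $F=\{(0,t)\}$. $\rho_\psi$ is the unique (up to isomorphism) irreducible smooth $R$-representation of $H$ with central character $\psi$; a model of it is a representation $(\rho_\psi,S)$ in this isomorphism class. For $g\in\mathrm{Sp}(W)$ there is $M_g\in\mathrm{GL}_R(S)$, unique up to $R^\times$, with $M_g\rho_\psi(w,t)M_g^{-1}=\rho_\psi(g^{-1}w,t)$ for all $(w,t)\in H$; $\sigma_S:\mathrm{Sp}(W)\to\mathrm{PGL}_R(S)$ is the resulting projective representation. $\widetilde{\mathrm{Sp}}_{\psi,S}^R(W)=\mathrm{Sp}(W)\times_{\mathrm{PGL}_R(S)}\mathrm{GL}_R(S)$ is the fibre product of $\sigma_S$ and the quotient map $\mathrm{GL}_R(S)\to\mathrm{PGL}_R(S)$, and $p_S$ is the projection to $\mathrm{Sp}(W)$. An isomorphism of central extensions is a group isomorphism compatible with the maps $i_S,i_{S'}$ and $p_S,p_{S'}$.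
   Formalization: M_g is taken to satisfy M_g ρ_ψ(w,t) M_g^{-1} = ρ_ψ(gw,t) rather than ρ_ψ(g^{-1}w,t): with the latter, g ↦ [M_g] is an anti-homomorphism and the fibre product is not a group when Sp(W) is non-commutative. *)

theory Defs
  imports "HOL-Analysis.Analysis" "HOL-Algebra.Coset"
begin

section \<open>The base field\<close>

locale nonarch_absolute_value =
  fixes absF :: "'f::field \<Rightarrow> real"
  assumes abs_nonneg: "absF x \<ge> 0"
    and abs_eq_0: "absF x = 0 \<longleftrightarrow> x = 0"
    and abs_mult: "absF (x * y) = absF x * absF y"
    and abs_ultrametric: "absF (x + y) \<le> max (absF x) (absF y)"

definition field_topology :: "('f::field \<Rightarrow> real) \<Rightarrow> 'f topology" where
  "field_topology absF = Metric_space.mtopology UNIV (\<lambda>x y. absF (x - y))"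

text \<open>The residue field is the quotient of the valuation ring \<open>{x. absF x \<le> 1}\<close> by its maximal
  ideal \<open>{x. absF x < 1}\<close>; it has characteristic \<open>p\<close> exactly when the prime \<open>p\<close> lies in that ideal.\<close>

definition nonarch_local_field :: "('f::field \<Rightarrow> real) \<Rightarrow> nat \<Rightarrow> bool" where
  "nonarch_local_field absF p \<longleftrightarrow>
     (\<exists>\<pi>. 0 < absF \<pi> \<and> absF \<pi> < 1 \<and> (\<forall>x. x \<noteq> 0 \<longrightarrow> (\<exists>k::int. absF x = absF \<pi> powi k))) \<and>
     Metric_space.mcomplete UNIV (\<lambda>x y. absF (x - y)) \<and>
     finite ({x. absF x \<le> 1} // {(x, y). absF x \<le> 1 \<and> absF y \<le> 1 \<and> absF (x - y) < 1}) \<and>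
     prime p \<and> absF (of_nat p) < 1"

text \<open>On a finite field every absolute value is trivial, so that \<^const>\<open>field_topology\<close> is
  the discrete topology in that case.\<close>

locale base_field = nonarch_absolute_value absF
  for absF :: "'f::field \<Rightarrow> real" +
  fixes p :: nat
  assumes finite_or_local:
      "(finite (UNIV :: 'f set) \<and> CHAR('f) = p) \<or> nonarch_local_field absF p"
    and char_neq_2: "(2 :: 'f) \<noteq> 0"

definition smooth_character :: "('f::field \<Rightarrow> real) \<Rightarrow> ('f \<Rightarrow> 'r::field) \<Rightarrow> bool" where
  "smooth_character absF \<psi> \<longleftrightarrow>
     (\<forall>x. \<psi> x \<noteq> 0) \<and> (\<forall>x y. \<psi> (x + y) = \<psi> x * \<psi> y) \<and>
     openin (field_topology absF) {x. \<psi> x = 1}"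

section \<open>Symplectic spaces and the Heisenberg group\<close>

definition symplectic_space ::
    "('f::field \<Rightarrow> 'w::ab_group_add \<Rightarrow> 'w) \<Rightarrow> ('w \<Rightarrow> 'w \<Rightarrow> 'f) \<Rightarrow> bool" where
  "symplectic_space sW \<omega> \<longleftrightarrow>
     (\<exists>B. finite_dimensional_vector_space sW B) \<and>
     (\<forall>w. Vector_Spaces.linear sW (*) (\<omega> w)) \<and>
     (\<forall>w. Vector_Spaces.linear sW (*) (\<lambda>v. \<omega> v w)) \<and>
     (\<forall>w. \<omega> w w = 0) \<and>
     (\<forall>w. (\<forall>v. \<omega> w v = 0) \<longrightarrow> w = 0)"

definition Sp ::
    "('f::field \<Rightarrow> 'w::ab_group_add \<Rightarrow> 'w) \<Rightarrow> ('w \<Rightarrow> 'w \<Rightarrow> 'f) \<Rightarrow> ('w \<Rightarrow> 'w) monoid" where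
  "Sp sW \<omega> = \<lparr>carrier = {g. Vector_Spaces.linear sW sW g \<and> bij g \<and> (\<forall>v w. \<omega> (g v) (g w) = \<omega> v w)},
              mult = (\<circ>), one = id\<rparr>"

definition heisenberg :: "('w::ab_group_add \<Rightarrow> 'w \<Rightarrow> 'f::field) \<Rightarrow> ('w \<times> 'f) monoid" where
  "heisenberg \<omega> = \<lparr>carrier = UNIV,
     mult = (\<lambda>(w, t) (w', t'). (w + w', t + t' + \<omega> w w' / 2)), one = (0, 0)\<rparr>"

text \<open>The topology of a finite-dimensional space \<open>W\<close>, given by all linear forms;
  for any basis it is the product topology transported from the coordinates.\<close>

definition vector_topology ::
    "('f::field \<Rightarrow> real) \<Rightarrow> ('f \<Rightarrow> 'w::ab_group_add \<Rightarrow> 'w) \<Rightarrow> 'w topology" where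
  "vector_topology absF sW = topology_generated_by
     {l -` U | l U. Vector_Spaces.linear sW (*) l \<and> openin (field_topology absF) U}"

definition heisenberg_topology ::
    "('f::field \<Rightarrow> real) \<Rightarrow> ('f \<Rightarrow> 'w::ab_group_add \<Rightarrow> 'w) \<Rightarrow> ('w \<times> 'f) topology" where
  "heisenberg_topology absF sW = prod_topology (vector_topology absF sW) (field_topology absF)"

section \<open>Models of the Heisenberg representation\<close>

definition GL :: "('r::field \<Rightarrow> 's::ab_group_add \<Rightarrow> 's) \<Rightarrow> ('s \<Rightarrow> 's) monoid" where
  "GL sS = \<lparr>carrier = {M. Vector_Spaces.linear sS sS M \<and> bij M}, mult = (\<circ>), one = id\<rparr>"

text \<open>By the Stone-von Neumann theorem the representations below form a single isomorphism class,
  that of \<open>\<rho>\<^sub>\<psi>\<close>.\<close>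

definition heisenberg_model ::
    "('f::field \<Rightarrow> real) \<Rightarrow> ('f \<Rightarrow> 'w::ab_group_add \<Rightarrow> 'w) \<Rightarrow> ('w \<Rightarrow> 'w \<Rightarrow> 'f) \<Rightarrow> ('f \<Rightarrow> 'r::field) \<Rightarrow>
     ('r \<Rightarrow> 's::ab_group_add \<Rightarrow> 's) \<Rightarrow> ('w \<times> 'f \<Rightarrow> 's \<Rightarrow> 's) \<Rightarrow> bool" where
  "heisenberg_model absF sW \<omega> \<psi> sS \<rho> \<longleftrightarrow>
     vector_space sS \<and>
     \<rho> \<in> hom (heisenberg \<omega>) (GL sS) \<and>
     (\<forall>v. openin (heisenberg_topology absF sW) {h. \<rho> h v = v}) \<and>
     (\<exists>v::'s. v \<noteq> 0) \<and>
     (\<forall>V. module.subspace sS V \<and> (\<forall>h. \<rho> h ` V \<subseteq> V) \<longrightarrow> V = {0} \<or> V = UNIV) \<and>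
     (\<forall>t v. \<rho> (0, t) v = sS (\<psi> t) v)"

definition rep_iso ::
    "('r::field \<Rightarrow> 's::ab_group_add \<Rightarrow> 's) \<Rightarrow> ('h \<Rightarrow> 's \<Rightarrow> 's) \<Rightarrow>
     ('r \<Rightarrow> 't::ab_group_add \<Rightarrow> 't) \<Rightarrow> ('h \<Rightarrow> 't \<Rightarrow> 't) \<Rightarrow> ('s \<Rightarrow> 't) \<Rightarrow> bool" where
  "rep_iso sS \<rho> sS' \<rho>' \<phi> \<longleftrightarrow>
     Vector_Spaces.linear sS sS' \<phi> \<and> bij \<phi> \<and> (\<forall>h. \<phi> \<circ> \<rho> h = \<rho>' h \<circ> \<phi>)"

section \<open>The projective representation and the metaplectic group\<close>

definition scalars :: "('r::field \<Rightarrow> 's::ab_group_add \<Rightarrow> 's) \<Rightarrow> ('s \<Rightarrow> 's) set" where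
  "scalars sS = {sS c | c. c \<noteq> 0}"

definition PGL :: "('r::field \<Rightarrow> 's::ab_group_add \<Rightarrow> 's) \<Rightarrow> ('s \<Rightarrow> 's) set monoid" where
  "PGL sS = GL sS Mod scalars sS"

definition to_PGL :: "('r::field \<Rightarrow> 's::ab_group_add \<Rightarrow> 's) \<Rightarrow> ('s \<Rightarrow> 's) \<Rightarrow> ('s \<Rightarrow> 's) set" where
  "to_PGL sS M = scalars sS #>\<^bsub>GL sS\<^esub> M"

text \<open>\<open>M\<close> is an operator \<open>M\<^sub>g\<close>.  The equation
  \<open>M\<^sub>g\<inverse> \<rho>(w, t) M\<^sub>g = \<rho>(g\<inverse> w, t)\<close>, that is \<open>M\<^sub>g \<rho>(w, t) M\<^sub>g\<inverse> = \<rho>(g w, t)\<close>, is the one for which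
  \<open>g \<mapsto> M\<^sub>g\<close> is multiplicative modulo scalars.  The variant \<open>M\<^sub>g \<rho>(w, t) M\<^sub>g\<inverse> = \<rho>(g\<inverse> w, t)\<close>, also
  found in the literature, literally gives
  \<open>M\<^sub>g M\<^sub>h \<rho>(w, t) (M\<^sub>g M\<^sub>h)\<inverse> = M\<^sub>g \<rho>(h\<inverse> w, t) M\<^sub>g\<inverse> = \<rho>((h g)\<inverse> w, t)\<close>, hence an
  anti-homomorphism, whose fibre product with \<open>GL\<close> is not a subgroup of \<open>Sp \<times> GL\<close>.\<close>

definition intertwines ::
    "('r::field \<Rightarrow> 's::ab_group_add \<Rightarrow> 's) \<Rightarrow> ('w \<times> 'f \<Rightarrow> 's \<Rightarrow> 's) \<Rightarrow> ('w \<Rightarrow> 'w) \<Rightarrow> ('s \<Rightarrow> 's) \<Rightarrow> bool"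
  where
  "intertwines sS \<rho> g M \<longleftrightarrow> M \<in> carrier (GL sS) \<and>
     (\<forall>w t. inv_into UNIV M \<circ> \<rho> (w, t) \<circ> M = \<rho> (inv_into UNIV g w, t))"

text \<open>Since \<open>M\<^sub>g\<close> is unique up to a scalar, its class in \<open>PGL\<close> is the set of all choices of \<open>M\<^sub>g\<close>.\<close>

definition \<sigma> ::
    "('r::field \<Rightarrow> 's::ab_group_add \<Rightarrow> 's) \<Rightarrow> ('w \<times> 'f \<Rightarrow> 's \<Rightarrow> 's) \<Rightarrow> ('w \<Rightarrow> 'w) \<Rightarrow> ('s \<Rightarrow> 's) set" where
  "\<sigma> sS \<rho> g = {M. intertwines sS \<rho> g M}"

definition fibre_product ::
    "('a, 'm) monoid_scheme \<Rightarrow> ('b, 'n) monoid_scheme \<Rightarrow> ('a \<Rightarrow> 'c) \<Rightarrow> ('b \<Rightarrow> 'c) \<Rightarrow> ('a \<times> 'b) monoid" where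
  "fibre_product G K f q =
     (G \<times>\<times> K)\<lparr>carrier := {(x, y). x \<in> carrier G \<and> y \<in> carrier K \<and> f x = q y}\<rparr>"

definition Mp ::
    "('f::field \<Rightarrow> 'w::ab_group_add \<Rightarrow> 'w) \<Rightarrow> ('w \<Rightarrow> 'w \<Rightarrow> 'f) \<Rightarrow>
     ('r::field \<Rightarrow> 's::ab_group_add \<Rightarrow> 's) \<Rightarrow> ('w \<times> 'f \<Rightarrow> 's \<Rightarrow> 's) \<Rightarrow> (('w \<Rightarrow> 'w) \<times> ('s \<Rightarrow> 's)) monoid" where
  "Mp sW \<omega> sS \<rho> = fibre_product (Sp sW \<omega>) (GL sS) (\<sigma> sS \<rho>) (to_PGL sS)"

definition i_map :: "('r::field \<Rightarrow> 's::ab_group_add \<Rightarrow> 's) \<Rightarrow> 'r \<Rightarrow> ('w \<Rightarrow> 'w) \<times> ('s \<Rightarrow> 's)" where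
  "i_map sS c = (id, \<lambda>v. sS c v)"

definition p_map :: "('w \<Rightarrow> 'w) \<times> ('s \<Rightarrow> 's) \<Rightarrow> 'w \<Rightarrow> 'w" where
  "p_map = fst"

section \<open>Central extensions\<close>

definition mult_group :: "'r::field itself \<Rightarrow> 'r monoid" where
  "mult_group _ = \<lparr>carrier = {x. x \<noteq> 0}, mult = (*), one = 1\<rparr>"

definition central_extension ::
    "('a, 'k) monoid_scheme \<Rightarrow> ('a \<Rightarrow> 'e) \<Rightarrow> ('e, 'm) monoid_scheme \<Rightarrow> ('e \<Rightarrow> 'g) \<Rightarrow>
     ('g, 'n) monoid_scheme \<Rightarrow> bool" where
  "central_extension A i E p G \<longleftrightarrow>
     group A \<and> group E \<and> group G \<and>
     i \<in> hom A E \<and> p \<in> hom E G \<and>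
     inj_on i (carrier A) \<and>
     i ` carrier A = kernel E G p \<and>
     p ` carrier E = carrier G \<and>
     (\<forall>a\<in>carrier A. \<forall>x\<in>carrier E. i a \<otimes>\<^bsub>E\<^esub> x = x \<otimes>\<^bsub>E\<^esub> i a)"

definition central_extension_iso ::
    "('a, 'k) monoid_scheme \<Rightarrow> ('a \<Rightarrow> 'e) \<Rightarrow> ('e, 'm) monoid_scheme \<Rightarrow> ('e \<Rightarrow> 'g) \<Rightarrow>
     ('a \<Rightarrow> 'e2) \<Rightarrow> ('e2, 'n) monoid_scheme \<Rightarrow> ('e2 \<Rightarrow> 'g) \<Rightarrow> ('e \<Rightarrow> 'e2) \<Rightarrow> bool" where
  "central_extension_iso A i E p i' E' p' f \<longleftrightarrow>
     f \<in> iso E E' \<and> (\<forall>a\<in>carrier A. f (i a) = i' a) \<and> (\<forall>x\<in>carrier E. p' (f x) = p x)"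

definition Mp_iso ::
    "('f::field \<Rightarrow> 'w::ab_group_add \<Rightarrow> 'w) \<Rightarrow> ('w \<Rightarrow> 'w \<Rightarrow> 'f) \<Rightarrow>
     ('r::field \<Rightarrow> 's::ab_group_add \<Rightarrow> 's) \<Rightarrow> ('w \<times> 'f \<Rightarrow> 's \<Rightarrow> 's) \<Rightarrow>
     ('r \<Rightarrow> 't::ab_group_add \<Rightarrow> 't) \<Rightarrow> ('w \<times> 'f \<Rightarrow> 't \<Rightarrow> 't) \<Rightarrow>
     (('w \<Rightarrow> 'w) \<times> ('s \<Rightarrow> 's) \<Rightarrow> ('w \<Rightarrow> 'w) \<times> ('t \<Rightarrow> 't)) \<Rightarrow> bool" where
  "Mp_iso sW \<omega> sS \<rho> sS' \<rho>' f \<longleftrightarrow>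
     central_extension_iso (mult_group TYPE('r))
       (i_map sS) (Mp sW \<omega> sS \<rho>) p_map (i_map sS') (Mp sW \<omega> sS' \<rho>') p_map f"

text \<open>Maps out of the metaplectic group are made extensional (\<^const>\<open>undefined\<close> off the carrier),
  so that equality of such maps is equality on the group.\<close>

definition conj_map ::
    "('f::field \<Rightarrow> 'w::ab_group_add \<Rightarrow> 'w) \<Rightarrow> ('w \<Rightarrow> 'w \<Rightarrow> 'f) \<Rightarrow>
     ('r::field \<Rightarrow> 's::ab_group_add \<Rightarrow> 's) \<Rightarrow> ('w \<times> 'f \<Rightarrow> 's \<Rightarrow> 's) \<Rightarrow> ('s \<Rightarrow> 't) \<Rightarrow>
     ('w \<Rightarrow> 'w) \<times> ('s \<Rightarrow> 's) \<Rightarrow> ('w \<Rightarrow> 'w) \<times> ('t \<Rightarrow> 't)" where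
  "conj_map sW \<omega> sS \<rho> \<phi> =
     restrict (\<lambda>(g, M). (g, \<phi> \<circ> M \<circ> inv_into UNIV \<phi>)) (carrier (Mp sW \<omega> sS \<rho>))"

definition \<Phi> ::
    "('f::field \<Rightarrow> 'w::ab_group_add \<Rightarrow> 'w) \<Rightarrow> ('w \<Rightarrow> 'w \<Rightarrow> 'f) \<Rightarrow>
     ('r::field \<Rightarrow> 's::ab_group_add \<Rightarrow> 's) \<Rightarrow> ('w \<times> 'f \<Rightarrow> 's \<Rightarrow> 's) \<Rightarrow>
     ('r \<Rightarrow> 't::ab_group_add \<Rightarrow> 't) \<Rightarrow> ('w \<times> 'f \<Rightarrow> 't \<Rightarrow> 't) \<Rightarrow>
     ('w \<Rightarrow> 'w) \<times> ('s \<Rightarrow> 's) \<Rightarrow> ('w \<Rightarrow> 'w) \<times> ('t \<Rightarrow> 't)" where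
  "\<Phi> sW \<omega> sS \<rho> sS' \<rho>' = conj_map sW \<omega> sS \<rho> (SOME \<phi>. rep_iso sS \<rho> sS' \<rho>' \<phi>)"

end

theory Submission
  imports Defs
begin

text \<open>Let \<open>L\<close> be a lattice in \<open>W\<close> that is its own annihilator for \<open>\<psi> \<circ> \<omega>\<close>, and let \<open>\<kappa>\<close> be a
  function on \<open>L\<close> making \<open>l \<mapsto> \<kappa> l * \<rho> (l, 0)\<close> a homomorphism. A smooth representation with central
  character \<open>\<psi>\<close> contains a nonzero vector \<open>v\<close> fixed by these operators, and every such vector in the
  representation generated by \<open>v\<close> is a multiple of \<open>v\<close>, since \<open>\<rho> (w, t) v\<close> is an eigenvector of \<open>L\<close>
  with a nontrivial character when \<open>w \<notin> L\<close>. This one-dimensionality gives Schur's lemma over an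
  arbitrary field, and, applied to the subrepresentation of \<open>S \<times> S'\<close> generated by \<open>(v, v')\<close>, the
  Stone-von Neumann theorem. Both together make the fibre product a central extension.

  Two isomorphisms of central extensions differ by a homomorphism from the symplectic group to the
  multiplicative group. The symplectic group is generated by transvections \<open>T\<^sub>v\<^sub>,\<^sub>a\<close>, and those with
  the same \<open>a\<close> are conjugate, so \<open>T\<^sub>v\<^sub>,\<^sub>a\<close> and \<open>T\<^sub>c\<^sub>v\<^sub>,\<^sub>a\<close>, which is \<open>T\<^sub>v\<^sub>,\<^sub>b\<close> for \<open>b = a c\<^sup>2\<close>, have the
  same image. This kills all transvections unless the field has three elements; in that case two
  orthogonal independent vectors \<open>v\<close>, \<open>e\<close> give \<open>T\<^sub>v\<^sub>+\<^sub>e T\<^sub>v\<^sub>-\<^sub>e T\<^sub>v T\<^sub>e = 1\<close>, so the common image has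
  order dividing both \<open>4\<close> and \<open>3\<close>.\<close>

section \<open>Symplectic spaces\<close>

locale symplectic = finite_dimensional_vector_space sW Bs
  for sW :: "'f::field \<Rightarrow> 'w::ab_group_add \<Rightarrow> 'w" and Bs +
  fixes \<omega> :: "'w \<Rightarrow> 'w \<Rightarrow> 'f"
  assumes linear_right: "Vector_Spaces.linear sW (*) (\<omega> w)"
    and linear_left: "Vector_Spaces.linear sW (*) (\<lambda>v. \<omega> v w)"
    and alternating [simp]: "\<omega> w w = 0"
    and nondegenerate: "(\<And>v. \<omega> w v = 0) \<Longrightarrow> w = 0"
begin

lemma form_add_right: "\<omega> w (u + v) = \<omega> w u + \<omega> w v"
  using linear_right[of w] by (simp add: Vector_Spaces.linear_iff)

lemma form_scale_right: "\<omega> w (sW c v) = c * \<omega> w v"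
  using linear_right[of w] by (simp add: Vector_Spaces.linear_iff)

lemma form_add_left: "\<omega> (u + v) w = \<omega> u w + \<omega> v w"
  using linear_left[of w] by (simp add: Vector_Spaces.linear_iff)

lemma form_scale_left: "\<omega> (sW c v) w = c * \<omega> v w"
  using linear_left[of w] by (simp add: Vector_Spaces.linear_iff)

lemma form_zero_right [simp]: "\<omega> w 0 = 0"
  using form_scale_right[of w 0 0] by simp

lemma form_zero_left [simp]: "\<omega> 0 w = 0"
  using form_scale_left[of 0 0 w] by simp

lemma form_minus_right: "\<omega> w (- v) = - \<omega> w v"
  using form_add_right[of w v "- v"] by (simp add: eq_neg_iff_add_eq_0 add.commute)

lemma form_minus_left: "\<omega> (- v) w = - \<omega> v w"
  using form_add_left[of v "- v" w] by (simp add: eq_neg_iff_add_eq_0 add.commute)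

lemma form_diff_right: "\<omega> w (u - v) = \<omega> w u - \<omega> w v"
  using form_add_right[of w u "- v"] by (simp add: form_minus_right)

lemma form_diff_left: "\<omega> (u - v) w = \<omega> u w - \<omega> v w"
  using form_add_left[of u "- v" w] by (simp add: form_minus_left)

lemmas form_simps = form_add_right form_add_left form_scale_right form_scale_left
  form_minus_right form_minus_left form_diff_right form_diff_left

lemma form_sum_left: "\<omega> (sum g I) w = (\<Sum>i\<in>I. \<omega> (g i) w)"
  by (induction I rule: infinite_finite_induct) (auto simp: form_simps)

lemma form_sum_right: "\<omega> w (sum g I) = (\<Sum>i\<in>I. \<omega> w (g i))"
  by (induction I rule: infinite_finite_induct) (auto simp: form_simps)

lemma form_skew: "\<omega> v w = - \<omega> w v"
proof -
  have "\<omega> (v + w) (v + w) = 0" by simp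
  moreover have "\<omega> (v + w) (v + w) = \<omega> v w + \<omega> w v"
    unfolding form_add_left form_add_right by simp
  ultimately have "\<omega> v w + \<omega> w v = 0" by simp
  then show ?thesis by (simp add: eq_neg_iff_add_eq_0)
qed

lemma ex_form_nonzero: "v \<noteq> 0 \<Longrightarrow> \<exists>x. \<omega> x v \<noteq> 0"
  using nondegenerate form_skew by (metis neg_equal_0_iff_equal)

text \<open>A vector space is not the union of two proper subspaces: if neither witness works for
  both \<open>u\<close> and \<open>v\<close>, their sum does.\<close>

lemma ex_form_nonzero2:
  assumes "u \<noteq> 0" "v \<noteq> 0"
  shows "\<exists>x. \<omega> x u \<noteq> 0 \<and> \<omega> x v \<noteq> 0"
proof -
  obtain y z where "\<omega> y u \<noteq> 0" "\<omega> z v \<noteq> 0"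
    using assms ex_form_nonzero by blast
  then show ?thesis
    by (metis form_add_left add_cancel_left_right add_cancel_right_right)
qed

subsection \<open>Transvections\<close>

lemma Sp_iff:
  "g \<in> carrier (Sp sW \<omega>) \<longleftrightarrow>
     (\<forall>x y. g (x + y) = g x + g y) \<and> (\<forall>c x. g (sW c x) = sW c (g x)) \<and> bij g \<and>
     (\<forall>v w. \<omega> (g v) (g w) = \<omega> v w)"
  using vector_space_axioms by (auto simp: Sp_def Vector_Spaces.linear_iff)

lemma Sp_mult [simp]: "g \<otimes>\<^bsub>Sp sW \<omega>\<^esub> h = g \<circ> h"
  and Sp_one [simp]: "\<one>\<^bsub>Sp sW \<omega>\<^esub> = id"
  by (simp_all add: Sp_def)

lemma Sp_inv_into:
  assumes "g \<in> carrier (Sp sW \<omega>)"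
  shows "inv_into UNIV g \<in> carrier (Sp sW \<omega>)"
proof -
  have b: "bij g" and "\<And>x. g (inv_into UNIV g x) = x" "\<And>x. inv_into UNIV g (g x) = x"
    using assms by (auto simp: Sp_iff bij_is_surj surj_f_inv_f bij_is_inj)
  then show ?thesis
    using assms unfolding Sp_iff by (metis bij_imp_bij_inv)
qed

lemma group_Sp: "group (Sp sW \<omega>)"
proof (rule groupI)
  fix g assume g: "g \<in> carrier (Sp sW \<omega>)"
  then have "inv_into UNIV g \<circ> g = id" by (simp add: Sp_iff bij_is_inj)
  then show "\<exists>h\<in>carrier (Sp sW \<omega>). h \<otimes>\<^bsub>Sp sW \<omega>\<^esub> g = \<one>\<^bsub>Sp sW \<omega>\<^esub>"
    using Sp_inv_into[OF g] by auto
qed (auto simp: Sp_iff bij_comp o_assoc)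

text \<open>Keeping \<open>a\<close> apart from \<open>v\<close> makes these maps an additive
  one-parameter group for fixed \<open>v\<close>, and rescaling \<open>v\<close> multiplies
  \<open>a\<close> by a square.\<close>

definition transvection :: "'w \<Rightarrow> 'f \<Rightarrow> 'w \<Rightarrow> 'w" where
  "transvection v a x = x + sW (a * \<omega> x v) v"

lemma transvection_add: "transvection v a \<circ> transvection v b = transvection v (a + b)"
  by (auto simp: transvection_def form_simps algebra_simps)

lemma transvection_0 [simp]: "transvection v 0 = id"
  by (auto simp: transvection_def)

lemma transvection_in_Sp: "transvection v a \<in> carrier (Sp sW \<omega>)"
proof -
  have "transvection v a \<circ> transvection v (-a) = id" "transvection v (-a) \<circ> transvection v a = id"
    by (simp_all add: transvection_add)
  then have "bij (transvection v a)" by (metis o_bij)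
  moreover have "\<omega> (transvection v a x) (transvection v a y) = \<omega> x y" for x y
    using form_skew[of v y] by (simp add: transvection_def form_simps algebra_simps)
  ultimately show ?thesis
    by (auto simp: Sp_iff transvection_def form_simps algebra_simps)
qed

text \<open>The conjugation rule, free of inverses, that makes transvections along nonzero vectors
  with equal \<open>a\<close> conjugate.\<close>

lemma Sp_transvection:
  "g \<in> carrier (Sp sW \<omega>) \<Longrightarrow> g \<circ> transvection v a = transvection (g v) a \<circ> g"
  by (auto simp: transvection_def Sp_iff)

lemma transvection_scale: "transvection (sW c v) a = transvection v (a * c\<^sup>2)"
  by (auto simp: transvection_def form_simps power2_eq_square algebra_simps)

lemma transvection_moves:
  assumes "\<omega> u v \<noteq> 0"
  shows "transvection (v - u) (1 / \<omega> u v) u = v"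
  using assms by (simp add: transvection_def form_simps)

lemma Sp_transitive:
  assumes "u \<noteq> 0" "v \<noteq> 0"
  shows "\<exists>g\<in>carrier (Sp sW \<omega>). g u = v"
proof -
  \<comment> \<open>\<open>transvection_moves\<close> needs non-orthogonal vectors, so the path from
    \<open>u\<close> to \<open>v\<close> passes through a vector orthogonal to neither.\<close>
  obtain x where x: "\<omega> u x \<noteq> 0" "\<omega> x v \<noteq> 0"
    using ex_form_nonzero2[OF assms] form_skew by (metis neg_equal_0_iff_equal)
  let ?g = "transvection (v - x) (1 / \<omega> x v) \<circ> transvection (x - u) (1 / \<omega> u x)"
  have "?g u = v" using x by (simp add: transvection_moves)
  moreover have "?g \<in> carrier (Sp sW \<omega>)"
    using group.is_monoid[OF group_Sp] monoid.m_closed transvection_in_Sp by (metis Sp_mult)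
  ultimately show ?thesis by blast
qed

lemma subspace_fixed_points:
  "g \<in> carrier (Sp sW \<omega>) \<Longrightarrow> subspace {x. g x = x}"
  by (simp add: Sp_iff subspace_def) (metis scale_zero_left)

lemma dim_fixed_points_less:
  assumes "g \<in> carrier (Sp sW \<omega>)" "h \<in> carrier (Sp sW \<omega>)"
    and "{x. g x = x} \<subset> {x. h x = x}"
  shows "dim {x. g x = x} < dim {x. h x = x}"
  using assms subspace_fixed_points by (intro dim_psubset) (simp add: span_eq_iff[THEN iffD2])

text \<open>If \<open>\<omega> x (g x) \<noteq> 0\<close>, then a transvection along \<open>g x - x\<close>, which is orthogonal to the fixed
  points of \<open>g\<close>, moves \<open>g x\<close> back to \<open>x\<close> and so enlarges the space of fixed points. If there is no such
  \<open>x\<close>, then composing with any transvection along a vector in the image of \<open>g - 1\<close> creates one.\<close>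

lemma Sp_transvection_induct [consumes 1, case_names id transvection]:
  assumes "g \<in> carrier (Sp sW \<omega>)"
    and id: "P id"
    and step: "\<And>v a g. g \<in> carrier (Sp sW \<omega>) \<Longrightarrow> P g \<Longrightarrow> P (transvection v a \<circ> g)"
  shows "P g"
  using assms(1)
\<comment> \<open>The induction is on the codimension of the space of fixed points.\<close>
proof (induction "dim (UNIV :: 'w set) - dim {x. g x = x}" arbitrary: g rule: less_induct)
  case (less g)
  note g = less.prems
  have orth: "\<omega> y (g z - z) = 0" if "g y = y" for y z
    using g that by (simp add: form_diff_right) (metis Sp_iff diff_self)
  have comp: "transvection v a \<circ> h \<in> carrier (Sp sW \<omega>)" if "h \<in> carrier (Sp sW \<omega>)" for v a h
    using that transvection_in_Sp monoid.m_closed[OF group.is_monoid[OF group_Sp]] by (metis Sp_mult)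
  have cancel: "transvection v (- a) \<circ> (transvection v a \<circ> h) = h" for v a h
    by (simp add: o_assoc transvection_add)
  have IH: "P h" if h: "h \<in> carrier (Sp sW \<omega>)" "{x. g x = x} \<subset> {x. h x = x}" for h
  proof (rule less.hyps)
    have "dim {x. h x = x} \<le> dim (UNIV :: 'w set)" by (rule dim_subset) auto
    then show "dim (UNIV :: 'w set) - dim {x. h x = x} < dim (UNIV :: 'w set) - dim {x. g x = x}"
      using dim_fixed_points_less[OF g h] by linarith
  qed (use h in auto)
  have reduce: "\<exists>v a. {x. h x = x} \<subset> {x. (transvection v a \<circ> h) x = x}"
    if h: "h \<in> carrier (Sp sW \<omega>)" and x: "\<omega> x (h x) \<noteq> 0" for h x
  proof -
    \<comment> \<open>Here \<open>a * \<omega> (h x) v = - 1\<close>, so the transvection subtracts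
      exactly \<open>h x - x\<close> from \<open>h x\<close>.\<close>
    define v a where "v = h x - x" and "a = - 1 / \<omega> x (h x)"
    have eq: "transvection v a (h x) = x"
      using x form_skew[of "h x" x] by (simp add: transvection_def v_def a_def form_simps)
    have "transvection v a (h y) = y" if "h y = y" for y
    proof -
      have "\<omega> y v = 0" using h that by (simp add: v_def form_diff_right) (metis Sp_iff diff_self)
      then show ?thesis using that by (simp add: transvection_def)
    qed
    moreover have "h x \<noteq> x" using x by auto
    ultimately show ?thesis using eq by (intro exI[of _ v] exI[of _ a]) auto
  qed
  show ?case
  proof (cases "\<exists>x. \<omega> x (g x) \<noteq> 0")
    case True
    then obtain v a where "{x. g x = x} \<subset> {x. (transvection v a \<circ> g) x = x}"
      using reduce[OF g] by blast
    then have "P (transvection v a \<circ> g)" by (intro IH comp g)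
    then show ?thesis using step[OF comp[OF g], of v a v "- a"] by (simp only: cancel)
  next
    case False
    show ?thesis
    proof (cases "g = id")
      case True
      then show ?thesis using id by simp
    next
      case nid: False
      then obtain z where z: "g z \<noteq> z" by (auto simp: fun_eq_iff)
      \<comment> \<open>As \<open>\<omega> x (g x)\<close> always vanishes,
        \<open>\<omega> x (h x)\<close> equals \<open>\<omega> (g x) v * \<omega> x v\<close>. With
        \<open>g u = v\<close> the first factor is \<open>\<omega> x u\<close>, so a suitable
        \<open>x\<close> makes both nonzero.\<close>
      define v where "v = g z - z"
      define h where "h = transvection v 1 \<circ> g"
      have h: "h \<in> carrier (Sp sW \<omega>)" unfolding h_def by (rule comp[OF g])
      have v: "v \<noteq> 0" using z by (simp add: v_def)
      obtain u where u: "g u = v" using g by (metis Sp_iff bij_is_surj surjD)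
      have "u \<noteq> 0"
      proof
        assume "u = 0"
        moreover have "g 0 = 0" using subspace_fixed_points[OF g] by (simp add: subspace_def)
        ultimately show False using u v by simp
      qed
      then obtain x where x: "\<omega> x u \<noteq> 0" "\<omega> x v \<noteq> 0" using ex_form_nonzero2 v by blast
      have "\<omega> (g x) v \<noteq> 0" using x(1) u g by (metis Sp_iff)
      then have "\<omega> x (h x) \<noteq> 0"
        using x False by (simp add: h_def transvection_def form_simps)
      then obtain v' a where va: "{x. h x = x} \<subset> {x. (transvection v' a \<circ> h) x = x}"
        using reduce[OF h] by blast
      have "{x. g x = x} \<subseteq> {x. h x = x}"
        using orth by (auto simp: h_def transvection_def v_def)
      then have "P (transvection v' a \<circ> h)" using va comp h by (intro IH) auto
      then have "P h" using step[OF comp[OF h], of v' a v' "- a"] by (simp only: cancel)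
      then show ?thesis
        using step[OF h, of v "- 1"] unfolding h_def by (simp only: cancel)
    qed
  qed
qed

lemma hom_Sp_trivial:
  assumes K: "comm_group K" and \<eta>: "\<eta> \<in> hom (Sp sW \<omega>) K"
    and nonexceptional: "\<not> (card (UNIV :: 'f set) = 3 \<and> dim (UNIV :: 'w set) = 2)"
    and two: "(2 :: 'f) \<noteq> 0"
    and g: "g \<in> carrier (Sp sW \<omega>)"
  shows "\<eta> g = \<one>\<^bsub>K\<^esub>"
proof -
  interpret K: comm_group K by (rule K)
  have closed: "\<eta> h \<in> carrier K" if "h \<in> carrier (Sp sW \<omega>)" for h
    using \<eta> that by (auto simp: hom_def)
  have mult: "\<eta> (h \<circ> k) = \<eta> h \<otimes>\<^bsub>K\<^esub> \<eta> k"
    if "h \<in> carrier (Sp sW \<omega>)" "k \<in> carrier (Sp sW \<omega>)" for h k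
    using \<eta> that unfolding hom_def by (metis (mono_tags, lifting) Sp_mult mem_Collect_eq)
  let ?T = transvection
  note T = transvection_in_Sp
  have closedT [simp]: "\<eta> (?T v a) \<in> carrier K" for v a by (rule closed[OF T])
  have one: "\<eta> id = \<one>\<^bsub>K\<^esub>"
    using \<eta> hom_one[OF \<eta> group_Sp K.is_group] by simp
  \<comment> \<open>The factor \<open>\<eta> h\<close> cancels because \<open>K\<close> is
    commutative.\<close>
  have conj: "\<eta> (?T (h v) a) = \<eta> (?T v a)" if h: "h \<in> carrier (Sp sW \<omega>)" for h v a
  proof -
    have "\<eta> h \<otimes>\<^bsub>K\<^esub> \<eta> (?T v a) = \<eta> (?T (h v) a) \<otimes>\<^bsub>K\<^esub> \<eta> h"
      using mult[OF h T] mult[OF T h] Sp_transvection[OF h] by metis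
    then show ?thesis using closed[OF h] by (metis K.right_cancel K.m_comm closedT)
  qed
  have indep: "\<eta> (?T u a) = \<eta> (?T v a)" if "u \<noteq> 0" "v \<noteq> 0" for u v a
    using Sp_transitive[OF that] conj by metis
  have zero: "\<eta> (?T 0 a) = \<one>\<^bsub>K\<^esub>" for a
    using transvection_scale[of 0 0 a] one by simp
  have addT: "\<eta> (?T v (a + b)) = \<eta> (?T v a) \<otimes>\<^bsub>K\<^esub> \<eta> (?T v b)" for v a b
    using mult[OF T T, of v a v b] by (simp only: transvection_add)
  have triv: "\<eta> (?T v a) = \<one>\<^bsub>K\<^esub>" for v a
  proof (cases "v = 0 \<or> a = 0")
    case True
    then show ?thesis using zero one by auto
  next
    case va: False
    show ?thesis
    proof (cases "\<exists>c::'f. c \<noteq> 0 \<and> c\<^sup>2 \<noteq> 1")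
      case True
      then obtain c :: 'f where c: "c \<noteq> 0" "c\<^sup>2 \<noteq> 1" by blast
      \<comment> \<open>With this \<open>b\<close>, \<open>?T (sW c v) b\<close> equals
        \<open>?T v (a + b)\<close>; since it has the same image as \<open>?T v b\<close>, the image
        of \<open>?T v a\<close> is trivial.\<close>
      define b where "b = a / (c\<^sup>2 - 1)"
      have b: "b * c\<^sup>2 = a + b" using c by (simp add: b_def field_simps)
      have "\<eta> (?T v b) = \<eta> (?T (sW c v) b)" using va c by (intro indep) auto
      also have "\<dots> = \<eta> (?T v a) \<otimes>\<^bsub>K\<^esub> \<eta> (?T v b)"
        by (simp add: transvection_scale b addT)
      finally show ?thesis by (metis K.r_cancel_one closedT)
    next
      case False
      \<comment> \<open>Every nonzero element now squares to 1, so the field has three elements and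
        the dimension is not 2.\<close>
      then have all: "c = 0 \<or> c = 1 \<or> c = - 1" for c :: 'f
        by (metis power2_eq_1_iff)
      then have UNIV: "(UNIV :: 'f set) = {0, 1, -1}" by auto
      have ne: "(1 :: 'f) \<noteq> - 1"
      proof
        assume "(1 :: 'f) = - 1"
        then have "(1 :: 'f) + 1 = 0" by (simp add: eq_neg_iff_add_eq_0)
        then show False using two by simp
      qed
      have "card (UNIV :: 'f set) = 3" unfolding UNIV using ne by auto
      then have dim: "dim (UNIV :: 'w set) \<noteq> 2" using nonexceptional by blast
      have three: "(1 :: 'f) + 1 + 1 = 0"
      proof -
        have "(1 :: 'f) + 1 = 0 \<or> (1 :: 'f) + 1 = 1 \<or> (1 :: 'f) + 1 = - 1" by (rule all)
        moreover have "(1 :: 'f) + 1 \<noteq> 1" by (metis add_cancel_right_right one_neq_zero)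
        ultimately have "(1 :: 'f) + 1 = - 1" using two by auto
        then show ?thesis by simp
      qed
      from va obtain f where f: "\<omega> v f \<noteq> 0" using nondegenerate by blast
      have fv: "f \<notin> span {v}"
        using f by (auto simp: span_singleton form_simps)
      have ind: "independent {f, v}" using va fv by (simp add: independent_insert)
      have "f \<noteq> v" using f by auto
      then have "card {f, v} = 2" by simp
      then have "span {f, v} \<noteq> UNIV" using ind dim by (metis dim_eq_card_independent dim_span)
      then obtain w where w: "w \<notin> span {f, v}" by blast
      \<comment> \<open>Removing from \<open>w\<close> its components in the plane of
        \<open>v\<close> and \<open>f\<close> leaves a nonzero vector orthogonal to
        \<open>v\<close>.\<close>
      define e where "e = w - sW (\<omega> w f / \<omega> v f) v - sW (\<omega> v w / \<omega> v f) f"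
      have "e \<notin> span {v}"
      proof
        assume "e \<in> span {v}"
        then have "e \<in> span {f, v}" using span_mono[of "{v}" "{f, v}"] by auto
        then have "e + sW (\<omega> w f / \<omega> v f) v + sW (\<omega> v w / \<omega> v f) f \<in> span {f, v}"
          by (intro span_add span_scale) (auto intro: span_base)
        then show False using w by (simp add: e_def)
      qed
      then have e: "e \<noteq> 0" "v + e \<noteq> 0" "v - e \<noteq> 0"
        using span_zero span_base[of v "{v}"] span_neg[of v "{v}"]
        by (auto simp: eq_neg_iff_add_eq_0[symmetric] add.commute)
      have ve: "\<omega> v e = 0" using f by (simp add: e_def form_simps)
      have ev: "\<omega> e v = 0" using ve form_skew[of e v] by simp
      \<comment> \<open>By orthogonality the cross terms from \<open>v + e\<close> and
        \<open>v - e\<close> cancel, and the terms along \<open>v\<close> and along \<open>e\<close>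
        each occur three times.\<close>
      have rel: "?T (v + e) a \<circ> ?T (v - e) a \<circ> ?T v a \<circ> ?T e a = id"
      proof
        fix x
        have tri: "sW c y + (sW c y + sW c y) = 0" for c y
        proof -
          have "c + (c + c) = c * (1 + 1 + 1)" by (simp add: algebra_simps)
          then show ?thesis using three by (simp add: scale_left_distrib[symmetric])
        qed
        have "(?T (v + e) a \<circ> ?T (v - e) a \<circ> ?T v a \<circ> ?T e a) x =
          x + (sW (a * \<omega> x v) v + (sW (a * \<omega> x v) v + sW (a * \<omega> x v) v)) +
            (sW (a * \<omega> x e) e + (sW (a * \<omega> x e) e + sW (a * \<omega> x e) e))"
          by (simp add: transvection_def form_simps ve ev algebra_simps)
        then show "(?T (v + e) a \<circ> ?T (v - e) a \<circ> ?T v a \<circ> ?T e a) x = id x"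
          by (simp only: tri) simp
      qed
      let ?t = "\<eta> (?T v a)"
      have Sp_comp: "h \<circ> k \<in> carrier (Sp sW \<omega>)"
        if "h \<in> carrier (Sp sW \<omega>)" "k \<in> carrier (Sp sW \<omega>)" for h k
        using that monoid.m_closed[OF group.is_monoid[OF group_Sp]] by (metis Sp_mult)
      have "\<eta> (?T (v + e) a) \<otimes>\<^bsub>K\<^esub> \<eta> (?T (v - e) a) \<otimes>\<^bsub>K\<^esub> ?t \<otimes>\<^bsub>K\<^esub> \<eta> (?T e a) = \<one>\<^bsub>K\<^esub>"
        using one by (simp add: rel[symmetric] mult T Sp_comp)
      \<comment> \<open>The vectors \<open>v\<close>, \<open>e\<close>, \<open>v + e\<close>,
        \<open>v - e\<close> are nonzero, so all four transvections have image \<open>?t\<close>.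
        Its cube is the image of \<open>?T v 0\<close>, because \<open>3 a = 0\<close>.\<close>
      then have four: "?t \<otimes>\<^bsub>K\<^esub> ?t \<otimes>\<^bsub>K\<^esub> ?t \<otimes>\<^bsub>K\<^esub> ?t = \<one>\<^bsub>K\<^esub>"
        using e va indep by metis
      have "a + a + a = a * (1 + 1 + 1)" by (simp add: algebra_simps)
      then have "?t \<otimes>\<^bsub>K\<^esub> ?t \<otimes>\<^bsub>K\<^esub> ?t = \<eta> (?T v 0)"
        using three by (simp add: addT[symmetric] del: transvection_0)
      then show ?thesis using four one by simp
    qed
  qed
  show ?thesis using g
  proof (induction rule: Sp_transvection_induct)
    case (transvection v a h)
    then show ?case using mult[OF T transvection(1), of v a] by (simp only: triv K.l_one K.one_closed)
  qed (rule one)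
qed

subsection \<open>Symplectic bases\<close>

definition hyperbolic_system :: "nat \<Rightarrow> (nat \<Rightarrow> 'w) \<Rightarrow> (nat \<Rightarrow> 'w) \<Rightarrow> bool" where
  "hyperbolic_system n e f \<longleftrightarrow> (\<forall>i<n. \<forall>j<n. \<omega> (e i) (e j) = 0 \<and> \<omega> (f i) (f j) = 0 \<and>
     \<omega> (e i) (f j) = (if i = j then 1 else 0))"

text \<open>Pairing with \<open>f m\<close> kills the span of the earlier \<open>e i\<close> but not
  \<open>e m\<close>, so the \<open>e i\<close> are independent. The bound yields a system of
  maximal length.\<close>

lemma hyperbolic_system_bound:
  assumes "hyperbolic_system n e f"
  shows "n \<le> dim (UNIV :: 'w set)"
proof -
  have "independent (e ` {..<m}) \<and> card (e ` {..<m}) = m" if "m \<le> n" for m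
    using that
  proof (induction m)
    case 0
    then show ?case by (simp add: independent_empty)
  next
    case (Suc m)
    have "\<omega> x (f m) = 0" if "x \<in> span (e ` {..<m})" for x
      using that
    proof (induction rule: span_induct_alt)
      case (step c x y)
      then show ?case using assms Suc.prems
        by (auto simp: form_simps hyperbolic_system_def)
    qed simp
    moreover have "\<omega> (e m) (f m) = 1" using assms Suc.prems by (auto simp: hyperbolic_system_def)
    ultimately have "e m \<notin> span (e ` {..<m})" by force
    then have "independent (insert (e m) (e ` {..<m}))" "e m \<notin> e ` {..<m}"
      using Suc by (auto simp: independent_insert intro: span_base)
    then show ?case using Suc by (simp add: lessThan_Suc)
  qed
  then have "independent (e ` {..<n})" "card (e ` {..<n}) = n" by auto
  then show ?thesis
    using independent_card_le_dim[of "e ` {..<n}" UNIV] by simp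
qed

text \<open>A system of maximal length is a basis: the remainder of \<open>w\<close> after
  projection is orthogonal to the system, and a nonzero remainder would provide one more hyperbolic
  pair.\<close>

lemma hyperbolic_basis_exists:
  "\<exists>n e f. hyperbolic_system n e f \<and>
     (\<forall>w. w = (\<Sum>i<n. sW (\<omega> w (f i)) (e i) + sW (\<omega> (e i) w) (f i)))"
proof -
  have "hyperbolic_system 0 (\<lambda>_. 0) (\<lambda>_. 0)" by (simp add: hyperbolic_system_def)
  then have "\<exists>n. (\<exists>e f. hyperbolic_system n e f) \<and> (\<forall>m. (\<exists>e f. hyperbolic_system m e f) \<longrightarrow> m \<le> n)"
    using hyperbolic_system_bound by (intro Nat.ex_has_greatest_nat) auto
  then obtain n where n: "\<exists>e f. hyperbolic_system n e f"
    and max: "\<And>m. \<exists>e f. hyperbolic_system m e f \<Longrightarrow> m \<le> n"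
    by blast
  obtain e f where ef: "hyperbolic_system n e f" using n by blast
  have rules: "\<omega> (e i) (e j) = 0" "\<omega> (f i) (f j) = 0" "\<omega> (e i) (f j) = (if i = j then 1 else 0)"
    if "i < n" "j < n" for i j
    using ef that by (auto simp: hyperbolic_system_def)
  define \<pi> where "\<pi> w = (\<Sum>i<n. sW (\<omega> w (f i)) (e i) + sW (\<omega> (e i) w) (f i))" for w
  have orth: "\<omega> (w - \<pi> w) (f j) = 0" "\<omega> (e j) (w - \<pi> w) = 0" if "j < n" for w j
  proof -
    have "\<omega> (\<pi> w) (f j) = (\<Sum>i<n. if i = j then \<omega> w (f i) else 0)"
      unfolding \<pi>_def form_sum_left using that
      by (intro sum.cong) (auto simp: form_simps rules)
    then show "\<omega> (w - \<pi> w) (f j) = 0" using that by (simp add: form_diff_left)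
    have "\<omega> (e j) (\<pi> w) = (\<Sum>i<n. if j = i then \<omega> (e i) w else 0)"
      unfolding \<pi>_def form_sum_right using that
      by (intro sum.cong) (auto simp: form_simps rules)
    then show "\<omega> (e j) (w - \<pi> w) = 0" using that by (simp add: form_diff_right)
  qed
  have "w = \<pi> w" for w
  proof (rule ccontr)
    assume "w \<noteq> \<pi> w"
    then obtain u0 where u0: "\<omega> (w - \<pi> w) u0 \<noteq> 0" using nondegenerate[of "w - \<pi> w"] by auto
    \<comment> \<open>Subtracting \<open>\<pi> u0\<close> makes \<open>u\<close> orthogonal to the
      system without changing its pairing with \<open>v\<close>; the scalar makes that pairing
      1.\<close>
    define v u where "v = w - \<pi> w" and "u = sW (1 / \<omega> v u0) (u0 - \<pi> u0)"
    have v: "\<omega> v (f j) = 0" "\<omega> (e j) v = 0" "\<omega> (f j) v = 0" "\<omega> v (e j) = 0" if "j < n" for j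
      using orth[OF that] form_skew[of "f j" v] form_skew[of v "e j"] by (auto simp: v_def)
    have u: "\<omega> u (f j) = 0" "\<omega> (e j) u = 0" "\<omega> (f j) u = 0" "\<omega> u (e j) = 0" if "j < n" for j
      using orth[OF that] form_skew[of "f j" u] form_skew[of u "e j"]
      by (auto simp: u_def form_scale_left form_scale_right)
    have "\<omega> v (\<pi> u0) = 0"
      unfolding \<pi>_def form_sum_right by (intro sum.neutral) (auto simp: form_simps v)
    then have "\<omega> v u = 1"
      using u0 by (simp add: u_def form_scale_right form_diff_right v_def[symmetric])
    then have "hyperbolic_system (Suc n) (e(n := v)) (f(n := u))"
      unfolding hyperbolic_system_def by (auto simp: less_Suc_eq rules u v)
    then show False using max[of "Suc n"] by auto
  qed
  then show ?thesis using ef unfolding \<pi>_def by blast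
qed

end

section \<open>Dual subgroups of the base field\<close>

text \<open>For a subgroup \<open>A'\<close> this says that \<open>A\<close> has finite image modulo
  \<open>A'\<close>; the representatives may lie outside \<open>A\<close>.\<close>

definition finitely_covered :: "'a::ab_group_add set \<Rightarrow> 'a set \<Rightarrow> bool" where
  "finitely_covered A A' \<longleftrightarrow> (\<exists>T. finite T \<and> (\<forall>a\<in>A. \<exists>t\<in>T. a - t \<in> A'))"

locale additive_character =
  fixes \<psi> :: "'f::field \<Rightarrow> 'r::field"
  assumes char_add: "\<psi> (x + y) = \<psi> x * \<psi> y"
    and char_nonzero [simp]: "\<psi> x \<noteq> 0"
begin

lemma char_zero [simp]: "\<psi> 0 = 1"
  using char_add[of 0 0] by simp

lemma char_minus: "\<psi> (- x) = inverse (\<psi> x)"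
  using char_add[of "- x" x] by (simp add: field_simps)

lemma char_diff: "\<psi> (x - y) = \<psi> x / \<psi> y"
  using char_add[of "x - y" y] by (simp add: field_simps)

lemma char_minus_eq_1 [simp]: "\<psi> (- x) = 1 \<longleftrightarrow> \<psi> x = 1"
  by (simp add: char_minus)

lemma char_sum_eq_1: "(\<And>i. i \<in> I \<Longrightarrow> \<psi> (g i) = 1) \<Longrightarrow> \<psi> (sum g I) = 1"
  by (induction I rule: infinite_finite_induct) (auto simp: char_add)

definition annih :: "'f set \<Rightarrow> 'f set" where
  "annih A = {b. \<forall>a\<in>A. \<psi> (a * b) = 1}"

text \<open>A substitute for compactness of \<open>A\<close> and \<open>annih A\<close>, suited to
  finite and local fields alike. As double annihilators, \<open>A'\<close> and \<open>B'\<close> are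
  subgroups whose cosets are separated by characters.\<close>

definition has_small_subgroups :: "('f \<Rightarrow> real) \<Rightarrow> 'f set \<Rightarrow> bool" where
  "has_small_subgroups absF A \<longleftrightarrow> (\<forall>\<delta>>0. \<exists>A' B'. A' \<subseteq> A \<and> B' \<subseteq> annih A \<and>
     annih (annih A') = A' \<and> annih (annih B') = B' \<and>
     finitely_covered A A' \<and> finitely_covered (annih A) B' \<and> (\<forall>x\<in>A' \<union> B'. absF x \<le> \<delta>))"

lemma annih_zero [simp]: "0 \<in> annih A"
  and annih_add: "x \<in> annih A \<Longrightarrow> y \<in> annih A \<Longrightarrow> x + y \<in> annih A"
  and annih_minus: "x \<in> annih A \<Longrightarrow> - x \<in> annih A"
  by (auto simp: annih_def distrib_left char_add)

end

lemma finitely_covered_trans: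
  assumes "finitely_covered A B" "finitely_covered B C"
  shows "finitely_covered A C"
proof -
  obtain S T where S: "finite S" "\<And>a. a \<in> A \<Longrightarrow> \<exists>s\<in>S. a - s \<in> B"
    and T: "finite T" "\<And>b. b \<in> B \<Longrightarrow> \<exists>t\<in>T. b - t \<in> C"
    using assms by (auto simp: finitely_covered_def)
  have "\<exists>u\<in>(\<lambda>(s, t). s + t) ` (S \<times> T). a - u \<in> C" if a: "a \<in> A" for a
  proof -
    obtain s where s: "s \<in> S" "a - s \<in> B" using S a by blast
    obtain t where "t \<in> T" "a - s - t \<in> C" using T s by blast
    then show ?thesis using s by (auto simp: diff_diff_eq intro!: bexI[of _ "(s, t)"])
  qed
  then show ?thesis unfolding finitely_covered_def
    using S T by (intro exI[of _ "(\<lambda>(s, t). s + t) ` (S \<times> T)"]) auto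
qed

section \<open>Non-archimedean absolute values and neighbourhoods of zero\<close>

context nonarch_absolute_value
begin

lemma abs_one [simp]: "absF 1 = 1"
  using abs_mult[of 1 1] abs_eq_0[of 1] by simp

lemma abs_zero [simp]: "absF 0 = 0"
  by (simp add: abs_eq_0)

lemma abs_power: "absF (x ^ n) = absF x ^ n"
  by (induction n) (auto simp: abs_mult)

lemma abs_inverse: "absF (inverse x) = inverse (absF x)"
proof (cases "x = 0")
  case False
  then have "absF x * absF (inverse x) = 1" by (simp add: abs_mult[symmetric])
  then show ?thesis by (metis inverse_unique)
qed simp

lemma abs_divide: "absF (x / y) = absF x / absF y"
  by (simp add: divide_inverse abs_mult abs_inverse)

lemma abs_power_int: "absF (x powi k) = absF x powi k"
  by (simp add: power_int_def abs_power abs_inverse)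

lemma abs_minus [simp]: "absF (- x) = absF x"
proof -
  have "absF (- 1) ^ 2 = 1" by (simp add: abs_power[symmetric])
  then have "absF (- 1) = 1" using abs_nonneg[of "- 1"] by (simp add: power2_eq_1_iff)
  then show ?thesis using abs_mult[of "- 1" x] by simp
qed

lemma abs_sum_le:
  assumes "\<And>i. i \<in> I \<Longrightarrow> absF (g i) \<le> r" "r \<ge> 0"
  shows "absF (sum g I) \<le> r"
  using assms(1)
proof (induction I rule: infinite_finite_induct)
  case (insert i I)
  have "absF (g i + sum g I) \<le> max (absF (g i)) (absF (sum g I))" by (rule abs_ultrametric)
  also have "\<dots> \<le> r" using insert by auto
  finally show ?case using insert by simp
qed (use assms in auto)

lemma Metric_space_abs: "Metric_space UNIV (\<lambda>x y. absF (x - y))"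
proof
  fix x y z :: 'f
  show "absF (x - y) = absF (y - x)" using abs_minus[of "x - y"] by simp
  have "absF ((x - y) + (y - z)) \<le> max (absF (x - y)) (absF (y - z))" by (rule abs_ultrametric)
  then show "absF (x - z) \<le> absF (x - y) + absF (y - z)"
    using abs_nonneg[of "x - y"] abs_nonneg[of "y - z"] by simp
qed (auto simp: abs_nonneg abs_eq_0)

lemma openin_field_topology:
  "openin (field_topology absF) U \<longleftrightarrow> (\<forall>x\<in>U. \<exists>r>0. \<forall>y. absF (x - y) < r \<longrightarrow> y \<in> U)"
proof -
  interpret Metric_space UNIV "\<lambda>x y. absF (x - y)" by (rule Metric_space_abs)
  show ?thesis by (auto simp: field_topology_def openin_mtopology mball_def subset_iff)
qed

lemma openin_field_topology_0:
  assumes "openin (field_topology absF) U" "0 \<in> U"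
  shows "\<exists>r>0. \<forall>x. absF x < r \<longrightarrow> x \<in> U"
  using assms abs_minus by (metis openin_field_topology diff_0)

end

section \<open>Balls in the base field and their annihilators\<close>

locale smooth_character_field = additive_character \<psi> + base_field absF p
  for \<psi> :: "'f::field \<Rightarrow> 'r::field" and absF :: "'f \<Rightarrow> real" and p :: nat +
  assumes char_smooth: "openin (field_topology absF) {x. \<psi> x = 1}"
    and char_nontrivial: "\<exists>x. \<psi> x \<noteq> 1"
begin

text \<open>If \<open>Ob k\<close> is the largest ball on which \<open>\<psi>\<close> is trivial,
  then \<open>Ob i\<close> has annihilator \<open>Ob (k - i)\<close>. Thus balls are double
  annihilators, and the finite residue field gives finite index between them.\<close>

lemma dual_subgroups_local:
  assumes loc: "nonarch_local_field absF p"
  shows "\<exists>A. annih (annih A) = A \<and> has_small_subgroups absF A"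
proof -
  obtain x0 where nontrivial: "\<psi> x0 \<noteq> 1" using char_nontrivial by blast
  obtain \<pi> where \<pi>: "0 < absF \<pi>" "absF \<pi> < 1"
    and vals: "\<And>x. x \<noteq> 0 \<Longrightarrow> \<exists>k::int. absF x = absF \<pi> powi k"
    and residue: "finite ({x. absF x \<le> 1} //
        {(x, y). absF x \<le> 1 \<and> absF y \<le> 1 \<and> absF (x - y) < 1})"
    using loc unfolding nonarch_local_field_def by blast
  define q where "q = absF \<pi>"
  have q: "0 < q" "q < 1" using \<pi> by (auto simp: q_def)
  define Ob where "Ob k = {x. absF x \<le> q powi k}" for k
  have antimono: "q powi l \<le> q powi k" if "k \<le> l" for k l
    using power_int_decreasing[OF that, of q] q by simp
  have Ob_mono: "Ob l \<subseteq> Ob k" if "k \<le> l" for k l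
    using antimono[OF that] by (auto simp: Ob_def)
  have strict: "k < l" if "q powi l < q powi k" for k l
    using that antimono[of l k] by (cases "k < l") auto
  obtain \<epsilon> where \<epsilon>: "\<epsilon> > 0" "\<And>x. absF x < \<epsilon> \<Longrightarrow> \<psi> x = 1"
    using openin_field_topology_0[OF char_smooth] by auto
  have small: "\<exists>m. \<forall>k\<ge>int m. q powi k < \<delta>" if \<delta>: "\<delta> > 0" for \<delta>
  proof -
    obtain m where "q ^ m < \<delta>" using real_arch_pow_inv[OF \<delta> q(2)] by blast
    then show ?thesis using antimono by (intro exI[of _ m]) (metis order_le_less_trans power_int_of_nat)
  qed
  obtain j where j: "absF x0 = q powi j" using vals[of x0] nontrivial by (metis q_def char_zero)
  define triv where "triv k \<longleftrightarrow> (\<forall>x\<in>Ob k. \<psi> x = 1)" for k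
  obtain m where m: "\<And>k. k \<ge> int m \<Longrightarrow> q powi k < \<epsilon>" using small[OF \<epsilon>(1)] by blast
  have "triv (j + int (nat (int m - j)))"
    unfolding triv_def Ob_def
  proof clarify
    fix x assume "absF x \<le> q powi (j + int (nat (int m - j)))"
    also have "\<dots> < \<epsilon>" by (rule m) simp
    finally show "\<psi> x = 1" by (rule \<epsilon>(2))
  qed
  then have ex: "\<exists>n. triv (j + int n)" by blast
  \<comment> \<open>\<open>Ob j\<close> contains \<open>x0\<close>, so the search starts where
    \<open>\<psi>\<close> is nontrivial. Hence \<open>N\<close> is positive and
    \<open>\<psi>\<close> is still nontrivial on the ball just before \<open>Ob k\<close>.\<close>
  define N where "N = (LEAST n. triv (j + int n))"
  define k where "k = j + int N"
  have k: "triv k" unfolding k_def N_def using LeastI_ex[OF ex] .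
  have "\<not> triv j" using j nontrivial by (auto simp: triv_def Ob_def intro!: exI[of _ x0])
  then have "N \<noteq> 0" using k by (metis k_def add.right_neutral of_nat_0)
  then have "\<not> triv (j + int (N - 1))"
    unfolding N_def by (intro not_less_Least) simp
  moreover have "j + int (N - 1) = k - 1" using \<open>N \<noteq> 0\<close> by (simp add: k_def of_nat_diff)
  ultimately have "\<not> triv (k - 1)" by simp
  then obtain x1 where x1: "absF x1 \<le> q powi (k - 1)" "\<psi> x1 \<noteq> 1" by (auto simp: triv_def Ob_def)
  have ann: "annih (Ob i) = Ob (k - i)" for i
  proof (intro equalityI subsetI)
    fix b assume b: "b \<in> Ob (k - i)"
    have "\<psi> (a * b) = 1" if "a \<in> Ob i" for a
    proof -
      have "absF (a * b) \<le> q powi i * q powi (k - i)"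
        unfolding abs_mult using that b q by (intro mult_mono) (auto simp: Ob_def abs_nonneg)
      also have "\<dots> = q powi k" using q by (simp add: power_int_add[symmetric])
      finally show ?thesis using k by (auto simp: triv_def Ob_def)
    qed
    then show "b \<in> annih (Ob i)" by (simp add: annih_def)
  next
    fix b assume b: "b \<in> annih (Ob i)"
    show "b \<in> Ob (k - i)"
    proof (rule ccontr)
      assume "b \<notin> Ob (k - i)"
      then have big: "q powi (k - i) < absF b" by (simp add: Ob_def)
      moreover have "0 < q powi (k - i)" using q by simp
      ultimately have b0: "b \<noteq> 0" by auto
      then obtain l where l: "absF b = q powi l" using vals unfolding q_def by blast
      then have lk: "l < k - i" using big strict by simp
      \<comment> \<open>If \<open>b\<close> is too large, \<open>x1 / b\<close> lies in
        \<open>Ob i\<close>, yet its product with \<open>b\<close> is \<open>x1\<close>, where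
        \<open>\<psi>\<close> is not 1.\<close>
      have "absF (x1 / b) = absF x1 / q powi l"
        by (simp add: abs_divide l)
      also have "\<dots> \<le> q powi (k - 1) / q powi l" using x1 q by (intro divide_right_mono) auto
      also have "\<dots> = q powi (k - 1 - l)" using q by (simp add: power_int_diff)
      also have "\<dots> \<le> q powi i" using lk by (intro antimono) simp
      finally have "x1 / b \<in> Ob i" by (simp add: Ob_def)
      then show False using b x1(2) b0 by (force simp: annih_def)
    qed
  qed
  have cov1: "finitely_covered (Ob i) (Ob (i + 1))" for i
  proof -
    let ?r = "{(x, y). absF x \<le> 1 \<and> absF y \<le> 1 \<and> absF (x - y) < 1}"
    define T where "T = (\<lambda>X. SOME x. x \<in> X) ` ({x. absF x \<le> 1} // ?r)"
    have "\<exists>t\<in>T. absF (a - t) < 1" if "absF a \<le> 1" for a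
    proof -
      have "a \<in> ?r `` {a}" using that by auto
      then have "(SOME x. x \<in> ?r `` {a}) \<in> ?r `` {a}" by (rule someI)
      then have "absF (a - (SOME x. x \<in> ?r `` {a})) < 1" by blast
      moreover have "?r `` {a} \<in> {x. absF x \<le> 1} // ?r" using that by (intro quotientI) simp
      ultimately show ?thesis unfolding T_def by blast
    qed
    \<comment> \<open>The value group is generated by \<open>q\<close>, so the maximal ideal is the
      ball of radius \<open>q\<close>.\<close>
    moreover have "absF x \<le> q" if "absF x < 1" for x
    proof (cases "x = 0")
      case False
      then obtain l where l: "absF x = q powi l" using vals unfolding q_def by blast
      then have "0 < l" using strict[of l 0] that by simp
      then show ?thesis using l antimono[of 1 l] by simp
    qed (use q in auto)
    ultimately have T: "\<exists>t\<in>T. absF (a - t) \<le> q" if "absF a \<le> 1" for a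
      using that by metis
    \<comment> \<open>A power of the uniformizer transports the representatives from
      \<open>Ob 0\<close> to \<open>Ob i\<close>.\<close>
    define c where "c = \<pi> powi i"
    have c: "absF c = q powi i" "c \<noteq> 0" using \<pi> by (auto simp: c_def q_def abs_power_int)
    have "\<exists>t\<in>(*) c ` T. a - t \<in> Ob (i + 1)" if "a \<in> Ob i" for a
    proof -
      have "absF (a / c) \<le> 1"
        using that c q by (simp add: Ob_def abs_divide)
      then obtain t where t: "t \<in> T" "absF (a / c - t) \<le> q" using T by blast
      have "a - c * t = c * (a / c - t)" using c by (simp add: field_simps)
      then have "absF (a - c * t) = q powi i * absF (a / c - t)" using c by (simp add: abs_mult)
      also have "\<dots> \<le> q powi i * q" using t q by (intro mult_left_mono) auto
      finally show ?thesis using t q by (auto simp: Ob_def power_int_add)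
    qed
    moreover have "finite T" unfolding T_def using residue by simp
    ultimately show ?thesis unfolding finitely_covered_def by (intro exI[of _ "(*) c ` T"]) auto
  qed
  have covered: "finitely_covered (Ob i) (Ob l)" if "i \<le> l" for i l
    using that
  proof (induction l rule: int_ge_induct)
    case base
    have "finitely_covered (Ob i) (Ob (i + 1))" by (rule cov1)
    then obtain T where "finite T" "\<forall>a\<in>Ob i. \<exists>t\<in>T. a - t \<in> Ob (i + 1)"
      unfolding finitely_covered_def by blast
    moreover have "Ob (i + 1) \<subseteq> Ob i" by (rule Ob_mono) simp
    ultimately show ?case unfolding finitely_covered_def by blast
  next
    case (step l)
    then show ?case using finitely_covered_trans cov1 by blast
  qed
  have "\<exists>A' B'. A' \<subseteq> Ob 0 \<and> B' \<subseteq> annih (Ob 0) \<and> annih (annih A') = A' \<and> annih (annih B') = B' \<and>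
       finitely_covered (Ob 0) A' \<and> finitely_covered (annih (Ob 0)) B' \<and> (\<forall>x\<in>A' \<union> B'. absF x \<le> \<delta>)"
    if \<delta>: "\<delta> > 0" for \<delta>
  proof -
    obtain m where "\<And>k. k \<ge> int m \<Longrightarrow> q powi k < \<delta>" using small[OF \<delta>] by blast
    \<comment> \<open>One ball serves as both \<open>A'\<close> and \<open>B'\<close>: the maximum
      puts it inside \<open>Ob 0\<close> and inside \<open>annih (Ob 0) = Ob k\<close>.\<close>
    then have "q powi max (int m) k < \<delta>" by simp
    then have "\<forall>x\<in>Ob (max (int m) k). absF x \<le> \<delta>" unfolding Ob_def by auto
    moreover have "Ob (max (int m) k) \<subseteq> Ob 0" "Ob (max (int m) k) \<subseteq> Ob k"
      by (rule Ob_mono; simp)+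
    moreover have "finitely_covered (Ob 0) (Ob (max (int m) k))" "finitely_covered (Ob k) (Ob (max (int m) k))"
      by (rule covered; simp)+
    ultimately show ?thesis
      by (intro exI[of _ "Ob (max (int m) k)"]) (simp add: ann)
  qed
  then have "has_small_subgroups absF (Ob 0)" unfolding has_small_subgroups_def by blast
  moreover have "annih (annih (Ob 0)) = Ob 0" by (simp add: ann)
  ultimately show ?thesis by blast
qed

lemma dual_subgroups_exist: "\<exists>A. annih (annih A) = A \<and> has_small_subgroups absF A"
  using finite_or_local
proof
  assume "nonarch_local_field absF p"
  then show ?thesis by (rule dual_subgroups_local)
next
  assume fin: "finite (UNIV :: 'f set) \<and> CHAR('f) = p"
  obtain x0 where nontrivial: "\<psi> x0 \<noteq> 1" using char_nontrivial by blast
  \<comment> \<open>In the finite case \<open>A\<close> is the whole field; a nonzero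
    \<open>b\<close> has \<open>x0\<close> among its multiples and so annihilates nothing of that
    size.\<close>
  have "b = 0" if "b \<in> annih UNIV" for b
  proof (rule ccontr)
    assume "b \<noteq> 0"
    then have "x0 / b * b = x0" by simp
    moreover have "\<psi> (x0 / b * b) = 1" using that unfolding annih_def by blast
    ultimately show False using nontrivial by simp
  qed
  then have ann: "annih UNIV = {0}" "annih {0} = UNIV" by (auto simp: annih_def)
  have cov: "finitely_covered X {0}" for X :: "'f set"
    using fin finite_subset[OF subset_UNIV, of X] unfolding finitely_covered_def
    by (intro exI[of _ X]) auto
  have "has_small_subgroups absF UNIV"
    unfolding has_small_subgroups_def by (intro allI impI exI[of _ "{0}"]) (simp add: ann cov)
  then show ?thesis by (intro exI[of _ UNIV]) (simp add: ann)
qed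

end

section \<open>Representations of the Heisenberg group\<close>

locale heisenberg_form = symplectic sW Bs \<omega> + additive_character \<psi>
  for sW :: "'f::field \<Rightarrow> 'w::ab_group_add \<Rightarrow> 'w" and Bs \<omega> and \<psi> :: "'f \<Rightarrow> 'r::field" +
  assumes two_nonzero: "(2 :: 'f) \<noteq> 0"
begin

lemma halves_add: "x / 2 + x / 2 = (x :: 'f)"
  using two_nonzero by (simp add: add_divide_distrib[symmetric] mult_2[symmetric])

end

locale heisenberg_rep = heisenberg_form sW Bs \<omega> \<psi> + V: vector_space sS
  for sW :: "'f::field \<Rightarrow> 'w::ab_group_add \<Rightarrow> 'w" and Bs \<omega> and \<psi> :: "'f \<Rightarrow> 'r::field"
    and sS :: "'r \<Rightarrow> 's::ab_group_add \<Rightarrow> 's" +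
  fixes \<rho> :: "'w \<times> 'f \<Rightarrow> 's \<Rightarrow> 's"
  assumes rep_linear: "Vector_Spaces.linear sS sS (\<rho> h)"
    and rep_mult: "\<rho> (w, t) (\<rho> (w', t') v) = \<rho> (w + w', t + t' + \<omega> w w' / 2) v"
    and rep_central: "\<rho> (0, t) v = sS (\<psi> t) v"
begin

lemma rep_add: "\<rho> h (u + v) = \<rho> h u + \<rho> h v"
  and rep_scale: "\<rho> h (sS c v) = sS c (\<rho> h v)"
  using rep_linear[of h] by (auto simp: Vector_Spaces.linear_iff)

lemma rep_zero [simp]: "\<rho> h 0 = 0"
  using rep_scale[of h 0 0] by simp

lemma rep_sum: "\<rho> h (sum g I) = (\<Sum>i\<in>I. \<rho> h (g i))"
  by (induction I rule: infinite_finite_induct) (auto simp: rep_add)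

lemma rep_one [simp]: "\<rho> (0, 0) v = v"
  by (simp add: rep_central)

lemma rep_inverse [simp]: "\<rho> (- w, - t) (\<rho> (w, t) v) = v"
  by (simp add: rep_mult form_minus_left)

lemma rep_decompose: "\<rho> (w, t) v = sS (\<psi> t) (\<rho> (w, 0) v)"
  by (simp add: rep_central[symmetric] rep_mult)

text \<open>The commutator of \<open>(l, 0)\<close> and \<open>(w, t)\<close> is the central element
  \<open>(0, \<omega> l w)\<close>, two halves of the form adding up.\<close>

lemma rep_commute: "\<rho> (l, 0) (\<rho> (w, t) v) = sS (\<psi> (\<omega> l w)) (\<rho> (w, t) (\<rho> (l, 0) v))"
proof -
  have half: "\<omega> l w / 2 = \<omega> l w + \<omega> w l / 2"
    using halves_add[of "\<omega> l w"] form_skew[of w l] by (simp add: algebra_simps)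
  have "\<rho> (l, 0) (\<rho> (w, t) v) = \<rho> (l + w, t + \<omega> l w / 2) v"
    by (simp add: rep_mult)
  also have "l + w = w + l" by (rule add.commute)
  also have "t + \<omega> l w / 2 = \<omega> l w + (t + \<omega> w l / 2)"
    unfolding half by (rule add.left_commute)
  also have "\<rho> (w + l, \<omega> l w + (t + \<omega> w l / 2)) v = \<rho> (0, \<omega> l w) (\<rho> (w, t) (\<rho> (l, 0) v))"
    by (simp add: rep_mult)
  finally show ?thesis by (simp only: rep_central)
qed

definition eigen :: "'w set \<Rightarrow> ('w \<Rightarrow> 'r) \<Rightarrow> 's \<Rightarrow> bool" where
  "eigen L \<kappa> v \<longleftrightarrow> (\<forall>l\<in>L. sS (\<kappa> l) (\<rho> (l, 0) v) = v)"

text \<open>The vectors \<open>\<rho> (w, t) v\<close> are eigenvectors of the operators \<open>\<rho> (l, 0)\<close>, \<open>l \<in> L\<close>. Whenever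
  \<open>w \<notin> L\<close>, some \<open>l\<close> has the wrong eigenvalue, and a polynomial in \<open>\<rho> (l, 0)\<close> kills that vector
  while fixing every vector of type \<open>(L, \<kappa>)\<close>, that is, every vector satisfying \<open>eigen L \<kappa>\<close>.\<close>

lemma eigen_unique:
  assumes nz: "\<And>l. l \<in> L \<Longrightarrow> \<kappa> l \<noteq> 0"
    and sep: "\<And>w. w \<notin> L \<Longrightarrow> \<exists>l\<in>L. \<psi> (\<omega> l w) \<noteq> 1"
    and v: "eigen L \<kappa> v" and u: "eigen L \<kappa> u" "u \<in> V.span (range (\<lambda>h. \<rho> h v))"
  shows "\<exists>c. u = sS c v"
proof -
  \<comment> \<open>Good operators fix the vectors of type \<open>(L, \<kappa>)\<close> and act
    diagonally on the orbit of \<open>v\<close>. The induction composes them to remove, one by one,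
    the terms with \<open>w\<close> outside \<open>L\<close>.\<close>
  define good where "good P \<longleftrightarrow> (\<forall>x y. P (x + y) = P x + P y) \<and> (\<forall>c x. P (sS c x) = sS c (P x)) \<and>
    (\<forall>x. eigen L \<kappa> x \<longrightarrow> P x = x) \<and> (\<forall>h. \<exists>c. P (\<rho> h v) = sS c (\<rho> h v))" for P
  have "\<exists>P c. good P \<and> P u = sS c v"
    using u(2)
  proof (induction rule: V.span_induct_alt)
    case base
    have "\<exists>c. \<rho> h v = sS c (\<rho> h v)" for h by (rule exI[of _ 1]) simp
    then have "good (\<lambda>x. x)" by (simp add: good_def)
    then show ?case by (intro exI[of _ "\<lambda>x. x"] exI[of _ 0]) simp
  next
    case (step a x y)
    then obtain P c where P: "good P" "P y = sS c v" by blast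
    obtain w t where x: "x = \<rho> (w, t) v" using step by auto
    obtain d where d: "P x = sS d x" using P x unfolding good_def by blast
    have Pu: "P (sS a x + y) = sS (a * d) x + sS c v" using P d by (simp add: good_def)
    show ?case
    proof (cases "w \<in> L")
      case True
      then have "sS (\<kappa> w) (\<rho> (w, 0) v) = v" using v by (simp add: eigen_def)
      then have "\<rho> (w, 0) v = sS (1 / \<kappa> w) v"
        using nz[OF True] by (metis V.scale_scale V.scale_one nonzero_divide_eq_eq)
      then have "x = sS (\<psi> t / \<kappa> w) v" unfolding x by (subst rep_decompose) simp
      then have "sS (a * d) x + sS c v = sS (a * d * (\<psi> t / \<kappa> w) + c) v"
        by (simp add: V.scale_left_distrib)
      then have "P (sS a x + y) = sS (a * d * (\<psi> t / \<kappa> w) + c) v"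
        by (simp only: Pu)
      then show ?thesis using P by blast
    next
      case False
      then obtain l where l: "l \<in> L" "\<psi> (\<omega> l w) \<noteq> 1" using sep by blast
      define b where "b = \<psi> (\<omega> l w)"
      \<comment> \<open>\<open>Q\<close> is normalised to be the identity on vectors of type
        \<open>(L, \<kappa>)\<close>, and it kills \<open>x\<close>, on which the twisted operator
        has eigenvalue \<open>b\<close>.\<close>
      define Q where "Q z = sS (1 / (1 - b)) (sS (\<kappa> l) (\<rho> (l, 0) z) - sS b z)" for z
      have b: "1 - b \<noteq> 0" using l by (simp add: b_def)
      have Q_add: "Q (z + z') = Q z + Q z'" and Q_scale: "Q (sS k z) = sS k (Q z)" for z z' k
        by (simp_all add: Q_def rep_add rep_scale V.scale_right_distrib V.scale_right_diff_distrib ac_simps)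
      have Q_eigen: "Q z = z" if "eigen L \<kappa> z" for z
      proof -
        have "Q z = sS (1 / (1 - b)) (sS (1 - b) z)"
          using that l by (simp add: Q_def eigen_def V.scale_left_diff_distrib)
        then show ?thesis using b by simp
      qed
      have Q_rep: "Q (\<rho> (w', t') v) = sS ((\<psi> (\<omega> l w') - b) / (1 - b)) (\<rho> (w', t') v)" for w' t'
      proof -
        have "sS (\<kappa> l) (\<rho> (l, 0) (\<rho> (w', t') v)) = sS (\<psi> (\<omega> l w')) (\<rho> (w', t') (sS (\<kappa> l) (\<rho> (l, 0) v)))"
          by (simp add: rep_commute rep_scale V.scale_left_commute mult.commute)
        also have "\<dots> = sS (\<psi> (\<omega> l w')) (\<rho> (w', t') v)"
          using v l by (simp add: eigen_def)
        finally show ?thesis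
          by (simp add: Q_def V.scale_left_diff_distrib[symmetric])
      qed
      have "\<exists>k. Q (P (\<rho> h v)) = sS k (\<rho> h v)" for h
      proof -
        obtain k where "P (\<rho> h v) = sS k (\<rho> h v)" using P unfolding good_def by blast
        then show ?thesis using Q_rep[of "fst h" "snd h"] by (auto simp: Q_scale)
      qed
      then have "good (\<lambda>z. Q (P z))" using P by (simp add: good_def Q_add Q_scale Q_eigen)
      moreover have "Q (P (sS a x + y)) = sS c v"
      proof -
        have "Q x = 0" using Q_rep[of w t] by (simp add: x b_def)
        then show ?thesis unfolding Pu Q_add Q_scale Q_eigen[OF v] by simp
      qed
      ultimately show ?thesis by blast
    qed
  qed
  \<comment> \<open>Since \<open>u\<close> is itself of type \<open>(L, \<kappa>)\<close>, the
    operator leaves it unchanged.\<close>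
  then show ?thesis using u(1) unfolding good_def by metis
qed

lemma rep_span_orbit: "u \<in> V.span (range (\<lambda>h. \<rho> h v)) \<Longrightarrow> \<rho> k u \<in> V.span (range (\<lambda>h. \<rho> h v))"
proof (induction rule: V.span_induct_alt)
  case base
  then show ?case by (simp add: V.span_zero)
next
  case (step c x y)
  then obtain h where x: "x = \<rho> h v" by blast
  have "\<rho> k x \<in> range (\<lambda>h. \<rho> h v)"
    using rep_mult[of "fst k" "snd k" "fst h" "snd h" v] by (simp add: x)
  then show ?case
    using step by (simp add: rep_add rep_scale V.span_add V.span_scale V.span_base)
qed

lemma span_orbit_self: "v \<in> V.span (range (\<lambda>h. \<rho> h v))"
  by (rule V.span_base) (metis rep_one rangeI)

end

subsection \<open>Lattices\<close>

locale heisenberg_lattice = heisenberg_form sW Bs \<omega> \<psi>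
  for sW :: "'f::field \<Rightarrow> 'w::ab_group_add \<Rightarrow> 'w" and Bs \<omega> and \<psi> :: "'f \<Rightarrow> 'r::field" +
  fixes n :: nat and e f :: "nat \<Rightarrow> 'w" and A :: "'f set"
  assumes system: "hyperbolic_system n e f"
    and expansion: "w = (\<Sum>i<n. sW (\<omega> w (f i)) (e i) + sW (\<omega> (e i) w) (f i))"
    and biannihilator: "annih (annih A) = A"
begin

lemma system_rules:
  assumes "i < n" "j < n"
  shows "\<omega> (e i) (e j) = 0" "\<omega> (f i) (f j) = 0" "\<omega> (e i) (f j) = (if i = j then 1 else 0)"
  using system assms by (auto simp: hyperbolic_system_def)

lemma form_expansion:
  "\<omega> v w = (\<Sum>i<n. \<omega> v (f i) * \<omega> (e i) w - \<omega> (e i) v * \<omega> w (f i))"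
proof -
  have "\<omega> v w = (\<Sum>i<n. \<omega> (sW (\<omega> v (f i)) (e i) + sW (\<omega> (e i) v) (f i)) w)"
    by (subst expansion[of v]) (rule form_sum_left)
  also have "\<dots> = (\<Sum>i<n. \<omega> v (f i) * \<omega> (e i) w - \<omega> (e i) v * \<omega> w (f i))"
    by (intro sum.cong refl) (metis form_add_left form_scale_left form_skew mult_minus_right diff_conv_add_uminus)
  finally show ?thesis .
qed

text \<open>The two pairings are the coordinates of \<open>w\<close> along \<open>e i\<close> and
  \<open>f i\<close>, so this is a product of copies of \<open>X\<close> and \<open>Y\<close> in the
  hyperbolic basis.\<close>

definition lat :: "'f set \<Rightarrow> 'f set \<Rightarrow> 'w set" where
  "lat X Y = {w. \<forall>i<n. \<omega> w (f i) \<in> X \<and> \<omega> (e i) w \<in> Y}"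

lemma lat_mono: "X \<subseteq> X' \<Longrightarrow> Y \<subseteq> Y' \<Longrightarrow> lat X Y \<subseteq> lat X' Y'"
  by (auto simp: lat_def)

lemma lat_annih_zero: "0 \<in> lat (annih X) (annih Y)"
  and lat_annih_add: "v \<in> lat (annih X) (annih Y) \<Longrightarrow> w \<in> lat (annih X) (annih Y) \<Longrightarrow>
    v + w \<in> lat (annih X) (annih Y)"
  and lat_annih_minus: "v \<in> lat (annih X) (annih Y) \<Longrightarrow> - v \<in> lat (annih X) (annih Y)"
  unfolding lat_def mem_Collect_eq form_add_left form_add_right form_minus_left form_minus_right
    form_zero_left form_zero_right
  by (blast intro: annih_zero annih_add annih_minus)+

text \<open>In coordinates, \<open>X\<close> meets only \<open>annih X\<close> and \<open>Y\<close>
  meets only \<open>annih Y\<close>.\<close>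

lemma lat_pairing:
  assumes "v \<in> lat X Y" "w \<in> lat (annih Y) (annih X)"
  shows "\<psi> (\<omega> v w) = 1"
proof (subst form_expansion, rule char_sum_eq_1)
  fix i assume "i \<in> {..<n}"
  then have "\<omega> v (f i) \<in> X" "\<omega> (e i) w \<in> annih X" "\<omega> (e i) v \<in> Y" "\<omega> w (f i) \<in> annih Y"
    using assms by (simp_all add: lat_def)
  then have "\<psi> (\<omega> v (f i) * \<omega> (e i) w) = 1" "\<psi> (\<omega> (e i) v * \<omega> w (f i)) = 1"
    unfolding annih_def by blast+
  then show "\<psi> (\<omega> v (f i) * \<omega> (e i) w - \<omega> (e i) v * \<omega> w (f i)) = 1"
    by (simp add: char_diff)
qed

text \<open>A coordinate outside the double annihilator \<open>X\<close> or \<open>Y\<close> is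
  detected by a multiple of the opposite basis vector.\<close>

lemma lat_separate:
  assumes "annih (annih X) = X" "annih (annih Y) = Y" and v: "v \<notin> lat X Y"
  shows "\<exists>w\<in>lat (annih Y) (annih X). \<psi> (\<omega> v w) \<noteq> 1"
proof -
  obtain i where i: "i < n" and "\<omega> v (f i) \<notin> annih (annih X) \<or> \<omega> (e i) v \<notin> annih (annih Y)"
    using v assms by (auto simp: lat_def)
  then consider b where "b \<in> annih X" "\<psi> (b * \<omega> v (f i)) \<noteq> 1"
    | a where "a \<in> annih Y" "\<psi> (a * \<omega> (e i) v) \<noteq> 1"
    by (auto simp: annih_def)
  then show ?thesis
  proof cases
    case 1
    then have "sW b (f i) \<in> lat (annih Y) (annih X)"
      using i by (auto simp: lat_def form_simps system_rules)
    then show ?thesis using 1 by (force simp: form_simps)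
  next
    case 2
    then have "sW a (e i) \<in> lat (annih Y) (annih X)"
      using i by (auto simp: lat_def form_simps system_rules)
    moreover have "\<omega> v (sW a (e i)) = - (a * \<omega> (e i) v)"
      using form_skew[of v "e i"] by (simp add: form_simps)
    ultimately show ?thesis using 2 by force
  qed
qed

lemma coordinates:
  assumes "j < n"
  shows "\<omega> (\<Sum>i<n. sW (s i) (e i) + sW (t i) (f i)) (f j) = s j"
    and "\<omega> (e j) (\<Sum>i<n. sW (s i) (e i) + sW (t i) (f i)) = t j"
proof -
  have "\<omega> (\<Sum>i<n. sW (s i) (e i) + sW (t i) (f i)) (f j) = (\<Sum>i<n. if i = j then s i else 0)"
    unfolding form_sum_left using assms
    by (intro sum.cong) (auto simp: form_simps system_rules)
  then show "\<omega> (\<Sum>i<n. sW (s i) (e i) + sW (t i) (f i)) (f j) = s j" using assms by simp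
  have "\<omega> (e j) (\<Sum>i<n. sW (s i) (e i) + sW (t i) (f i)) = (\<Sum>i<n. if j = i then t i else 0)"
    unfolding form_sum_right using assms
    by (intro sum.cong) (auto simp: form_simps system_rules)
  then show "\<omega> (e j) (\<Sum>i<n. sW (s i) (e i) + sW (t i) (f i)) = t j" using assms by simp
qed

lemma finitely_covered_lat:
  assumes "finitely_covered X X'" "finitely_covered Y Y'"
  shows "finitely_covered (lat X Y) (lat X' Y')"
proof -
  obtain S T where S: "finite S" "\<And>x. x \<in> X \<Longrightarrow> \<exists>s\<in>S. x - s \<in> X'"
    and T: "finite T" "\<And>y. y \<in> Y \<Longrightarrow> \<exists>t\<in>T. y - t \<in> Y'"
    using assms by (auto simp: finitely_covered_def)
  define F where "F = (\<lambda>(s, t). \<Sum>i<n. sW (s i) (e i) + sW (t i) (f i)) `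
    (PiE {..<n} (\<lambda>_. S) \<times> PiE {..<n} (\<lambda>_. T))"
  have "\<exists>u\<in>F. w - u \<in> lat X' Y'" if w: "w \<in> lat X Y" for w
  proof -
    have "\<forall>i\<in>{..<n}. \<exists>s. s \<in> S \<and> \<omega> w (f i) - s \<in> X'" "\<forall>i\<in>{..<n}. \<exists>t. t \<in> T \<and> \<omega> (e i) w - t \<in> Y'"
      using w S(2) T(2) unfolding lat_def by blast+
    then obtain s t where s: "\<And>i. i < n \<Longrightarrow> s i \<in> S \<and> \<omega> w (f i) - s i \<in> X'"
      and t: "\<And>i. i < n \<Longrightarrow> t i \<in> T \<and> \<omega> (e i) w - t i \<in> Y'"
      by (metis (no_types, lifting) bchoice lessThan_iff)
    define s' t' where "s' = restrict s {..<n}" and "t' = restrict t {..<n}"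
    have "(\<Sum>i<n. sW (s' i) (e i) + sW (t' i) (f i)) \<in> F"
      unfolding F_def using s t by (intro image_eqI[of _ _ "(s', t')"]) (auto simp: s'_def t'_def)
    moreover have "w - (\<Sum>i<n. sW (s' i) (e i) + sW (t' i) (f i)) \<in> lat X' Y'"
      using s t by (simp add: lat_def form_diff_left form_diff_right coordinates s'_def t'_def)
    ultimately show ?thesis by blast
  qed
  moreover have "finite F" unfolding F_def using S T by (simp add: finite_PiE)
  ultimately show ?thesis unfolding finitely_covered_def by blast
qed

text \<open>Taking annihilators and exchanging the factors returns the same set, so it is its own
  annihilator for \<open>\<psi> (\<omega> v w)\<close>.\<close>

definition L :: "'w set" where
  "L = lat A (annih A)"

text \<open>The cocycle \<open>\<psi> (\<omega> l m / 2)\<close> may be nontrivial on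
  \<open>L\<close>, for instance if \<open>p = 2\<close>. This quadratic function trivialises
  it.\<close>

definition \<kappa> :: "'w \<Rightarrow> 'r" where
  "\<kappa> l = \<psi> (\<Sum>i<n. \<omega> l (f i) * \<omega> (e i) l / 2)"

lemma \<kappa>_nonzero [simp]: "\<kappa> l \<noteq> 0"
  by (simp add: \<kappa>_def)

lemma L_zero: "0 \<in> L"
  and L_add: "v \<in> L \<Longrightarrow> w \<in> L \<Longrightarrow> v + w \<in> L"
  and L_minus: "v \<in> L \<Longrightarrow> - v \<in> L"
  using lat_annih_zero[of "annih A" A] lat_annih_add[of _ "annih A" A]
    lat_annih_minus[of _ "annih A" A] by (simp_all add: L_def biannihilator)

lemma L_separate: "w \<notin> L \<Longrightarrow> \<exists>l\<in>L. \<psi> (\<omega> l w) \<noteq> 1"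
  using lat_separate[of A "annih A" w] form_skew[of _ w] unfolding L_def biannihilator
  by (metis char_minus_eq_1)

text \<open>Expanding the product of coordinates gives half the form plus cross terms in which an
  element of \<open>A\<close> meets one of \<open>annih A\<close>, so \<open>\<psi>\<close> does not
  see them.\<close>

lemma \<kappa>_add:
  assumes "l \<in> L" "m \<in> L"
  shows "\<kappa> (l + m) = \<kappa> l * \<kappa> m * \<psi> (\<omega> l m / 2)"
proof -
  have "(l1 + m1) * (l2 + m2) / 2 = l1 * l2 / 2 + m1 * m2 / 2 + (l1 * m2 - l2 * m1) / 2 + m1 * l2"
    for l1 l2 m1 m2 :: 'f
    using halves_add[of "m1 * l2"] by (simp add: algebra_simps add_divide_distrib diff_divide_distrib)
  then have "(\<Sum>i<n. \<omega> (l + m) (f i) * \<omega> (e i) (l + m) / 2) =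
    (\<Sum>i<n. \<omega> l (f i) * \<omega> (e i) l / 2) + (\<Sum>i<n. \<omega> m (f i) * \<omega> (e i) m / 2) +
    \<omega> l m / 2 + (\<Sum>i<n. \<omega> m (f i) * \<omega> (e i) l)"
    unfolding form_expansion[of l m] sum_divide_distrib sum.distrib[symmetric]
    by (intro sum.cong refl) (simp only: form_add_left form_add_right)
  moreover have "\<psi> (\<Sum>i<n. \<omega> m (f i) * \<omega> (e i) l) = 1"
    using assms by (intro char_sum_eq_1) (auto simp: L_def lat_def annih_def)
  ultimately show ?thesis by (simp add: \<kappa>_def char_add)
qed

text \<open>By the ultrametric inequality a linear form is bounded by a constant times the largest
  coordinate. This settles the subbasic sets, and induction on the generation of the topology does
  the rest.\<close>

lemma vector_topology_nhds_0:
  assumes "nonarch_absolute_value absF" "openin (vector_topology absF sW) U" "0 \<in> U"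
  shows "\<exists>\<delta>>0. \<forall>w\<in>lat {x. absF x \<le> \<delta>} {x. absF x \<le> \<delta>}. w \<in> U"
proof -
  interpret nonarch_absolute_value absF by (rule assms)
  have "generate_topology_on {l -` U | l U. Vector_Spaces.linear sW (*) l \<and> openin (field_topology absF) U} U"
    using assms(2) by (simp add: vector_topology_def openin_topology_generated_by_iff)
  then show ?thesis using assms(3)
  proof (induction rule: generate_topology_on.induct)
    case (Int a b)
    then obtain \<delta> \<epsilon> where "\<delta> > 0" "\<forall>w\<in>lat {x. absF x \<le> \<delta>} {x. absF x \<le> \<delta>}. w \<in> a"
      and "\<epsilon> > 0" "\<forall>w\<in>lat {x. absF x \<le> \<epsilon>} {x. absF x \<le> \<epsilon>}. w \<in> b" by blast
    then show ?case by (intro exI[of _ "min \<delta> \<epsilon>"]) (auto simp: lat_def)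
  next
    case (UN K)
    then show ?case by blast
  next
    case (Basis s)
    then obtain l U where s: "s = l -` U" and l: "Vector_Spaces.linear sW (*) l"
      and U: "openin (field_topology absF) U" by blast
    have l_add: "l (u + v) = l u + l v" and l_scale: "l (sW c v) = c * l v" for u v c
      using l by (auto simp: Vector_Spaces.linear_iff)
    have l0: "l 0 = 0" using l_scale[of 0 0] by simp
    have l_sum: "l (sum g I) = (\<Sum>i\<in>I. l (g i))" for g and I :: "nat set"
      by (induction I rule: infinite_finite_induct) (auto simp: l_add l0)
    obtain r where r: "r > 0" "\<And>x. absF x < r \<Longrightarrow> x \<in> U"
      using openin_field_topology_0[OF U] Basis s l0 by auto
    \<comment> \<open>The summand 1 keeps \<open>M\<close> positive even if
      \<open>n = 0\<close>.\<close>
    define M where "M = 1 + (\<Sum>i<n. absF (l (e i)) + absF (l (f i)))"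
    have "M \<ge> 1" by (simp add: M_def sum_nonneg abs_nonneg)
    have bound: "absF (l (e i)) \<le> M" "absF (l (f i)) \<le> M" if "i < n" for i
    proof -
      have "absF (l (e i)) + absF (l (f i)) \<le> (\<Sum>i<n. absF (l (e i)) + absF (l (f i)))"
        by (rule member_le_sum) (use that in \<open>auto simp: abs_nonneg\<close>)
      then show "absF (l (e i)) \<le> M" "absF (l (f i)) \<le> M"
        using abs_nonneg[of "l (e i)"] abs_nonneg[of "l (f i)"] by (simp_all add: M_def del: abs_nonneg)
    qed
    define \<delta> where "\<delta> = r / 2 / M"
    have \<delta>: "\<delta> > 0" "\<delta> * M = r / 2" using \<open>M \<ge> 1\<close> r by (auto simp: \<delta>_def)
    have "w \<in> s" if w: "w \<in> lat {x. absF x \<le> \<delta>} {x. absF x \<le> \<delta>}" for w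
    proof -
      have "l w = (\<Sum>i<n. \<omega> w (f i) * l (e i) + \<omega> (e i) w * l (f i))"
        by (subst expansion[of w]) (simp add: l_sum l_add l_scale)
      moreover have "absF (\<Sum>i<n. \<omega> w (f i) * l (e i) + \<omega> (e i) w * l (f i)) \<le> r / 2"
      proof (rule abs_sum_le)
        fix i assume "i \<in> {..<n}"
        then have "absF (\<omega> w (f i)) * absF (l (e i)) \<le> \<delta> * M" "absF (\<omega> (e i) w) * absF (l (f i)) \<le> \<delta> * M"
          using w \<delta> bound by (auto simp: lat_def abs_nonneg intro!: mult_mono)
        then show "absF (\<omega> w (f i) * l (e i) + \<omega> (e i) w * l (f i)) \<le> r / 2"
          using abs_ultrametric[of "\<omega> w (f i) * l (e i)" "\<omega> (e i) w * l (f i)"] \<delta>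
          by (simp add: abs_mult)
      qed (use r in auto)
      ultimately show ?thesis using r s by simp
    qed
    then show ?case using \<delta> by blast
  qed auto
qed

lemma \<kappa>_eq_1_near_0:
  assumes "nonarch_absolute_value absF" "openin (field_topology absF) {x. \<psi> x = 1}"
  shows "\<exists>\<delta>>0. \<forall>w\<in>lat {x. absF x \<le> \<delta>} {x. absF x \<le> \<delta>}. \<kappa> w = 1"
proof -
  interpret nonarch_absolute_value absF by (rule assms)
  obtain r where r: "r > 0" "\<And>x. absF x < r \<Longrightarrow> \<psi> x = 1"
    using openin_field_topology_0[OF assms(2)] by auto
  have a2: "absF 2 > 0" using two_nonzero abs_nonneg[of 2] abs_eq_0[of 2] by linarith
  \<comment> \<open>The bound 1 keeps a product of two such elements below \<open>\<delta>\<close>;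
    the factor \<open>absF 2\<close> pays for the division by 2.\<close>
  define \<delta> where "\<delta> = min 1 (r / 2 * absF 2)"
  have \<delta>: "0 < \<delta>" "\<delta> \<le> 1" "\<delta> \<le> r / 2 * absF 2" using r a2 by (auto simp: \<delta>_def)
  have "\<psi> (a * b / 2) = 1" if "absF a \<le> \<delta>" "absF b \<le> \<delta>" for a b
  proof -
    have "absF a * absF b \<le> \<delta> * 1" using that \<delta> by (intro mult_mono) (auto simp: abs_nonneg)
    also have "\<dots> < r * absF 2" using \<delta> r a2 by (simp add: field_simps)
    finally have "absF (a * b / 2) < r"
      using a2 by (simp add: abs_divide abs_mult pos_divide_less_eq)
    then show ?thesis by (rule r)
  qed
  then show ?thesis using \<delta>
    by (intro exI[of _ \<delta>]) (auto simp: \<kappa>_def lat_def intro!: char_sum_eq_1)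
qed

end

subsection \<open>Vectors fixed by a lattice\<close>

text \<open>Dedekind's argument with vector coefficients: subtracting \<open>\<eta> s g\<close>
  times the relation at \<open>h\<close> from the relation at \<open>g + h\<close> eliminates the
  term \<open>s\<close>.\<close>

lemma (in vector_space) dedekind_independence:
  fixes \<eta> :: "'t \<Rightarrow> 'g::monoid_add \<Rightarrow> 'a"
  assumes "finite T"
    and one: "\<And>t. t \<in> T \<Longrightarrow> \<eta> t 0 = 1" "0 \<in> G"
    and mult: "\<And>t g h. t \<in> T \<Longrightarrow> g \<in> G \<Longrightarrow> h \<in> G \<Longrightarrow> \<eta> t (g + h) = \<eta> t g * \<eta> t h"
    and closed: "\<And>g h. g \<in> G \<Longrightarrow> h \<in> G \<Longrightarrow> g + h \<in> G"
    and distinct: "\<And>t u. t \<in> T \<Longrightarrow> u \<in> T \<Longrightarrow> t \<noteq> u \<Longrightarrow> \<exists>g\<in>G. \<eta> t g \<noteq> \<eta> u g"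
    and zero: "\<And>g. g \<in> G \<Longrightarrow> (\<Sum>t\<in>T. scale (\<eta> t g) (x t)) = 0"
    and t: "t \<in> T"
  shows "x t = 0"
  using assms(1) one(1) mult distinct zero t
proof (induction T arbitrary: x t rule: finite_induct)
  case empty
  then show ?case by simp
next
  case (insert s T)
  have T0: "x u = 0" if u: "u \<in> T" for u
  proof -
    have "scale (\<eta> u g - \<eta> s g) (x u) = 0" if g: "g \<in> G" for g
    proof (rule insert.IH[of "\<lambda>u. scale (\<eta> u g - \<eta> s g) (x u)"])
      fix h assume h: "h \<in> G"
      have "(\<Sum>t\<in>T. scale (\<eta> t h) (scale (\<eta> t g - \<eta> s g) (x t))) =
        (\<Sum>t\<in>insert s T. scale (\<eta> t h) (scale (\<eta> t g - \<eta> s g) (x t)))"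
        using insert.hyps by simp
      also have "\<dots> = (\<Sum>t\<in>insert s T. scale (\<eta> t (g + h)) (x t) - scale (\<eta> s g) (scale (\<eta> t h) (x t)))"
        using insert.prems(2) g h
        by (intro sum.cong refl) (simp add: algebra_simps)
      also have "\<dots> = (\<Sum>t\<in>insert s T. scale (\<eta> t (g + h)) (x t)) -
          scale (\<eta> s g) (\<Sum>t\<in>insert s T. scale (\<eta> t h) (x t))"
        by (simp only: sum_subtractf scale_sum_right)
      also have "\<dots> = 0" using insert.prems(4) closed g h by simp
      finally show "(\<Sum>t\<in>T. scale (\<eta> t h) (scale (\<eta> t g - \<eta> s g) (x t))) = 0" .
    qed (use insert.prems u in auto)
    moreover obtain g where "g \<in> G" "\<eta> u g \<noteq> \<eta> s g"
      using insert.prems(3)[of u s] insert.hyps u by auto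
    ultimately show ?thesis by fastforce
  qed
  moreover have "x s = 0"
    using insert.prems(4)[OF one(2)] insert.prems(1) insert.hyps T0 by simp
  ultimately show ?case using insert.prems(5) by auto
qed

text \<open>The condition defining the choice depends only on the coset of \<open>a\<close>. So
  \<open>r\<close> is constant on cosets and takes finitely many values on \<open>A\<close>, even if
  the covering set lies outside \<open>A\<close>.\<close>

lemma transversal_exists:
  fixes A A' :: "'a::ab_group_add set"
  assumes cov: "finitely_covered A A'"
    and add: "\<And>x y. x \<in> A' \<Longrightarrow> y \<in> A' \<Longrightarrow> x + y \<in> A'"
    and minus: "\<And>x. x \<in> A' \<Longrightarrow> - x \<in> A'" and zero: "0 \<in> A'"
  shows "\<exists>r. finite (r ` A) \<and> (\<forall>a\<in>A. r a \<in> A \<and> a - r a \<in> A') \<and>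
    (\<forall>a\<in>A. \<forall>b\<in>A. a - b \<in> A' \<longrightarrow> r a = r b)"
proof -
  have diff: "x - y \<in> A'" if "x \<in> A'" "y \<in> A'" for x y
    using add[OF that(1) minus[OF that(2)]] by simp
  define r where "r a = (SOME b. b \<in> A \<and> a - b \<in> A')" for a
  have r: "r a \<in> A \<and> a - r a \<in> A'" if "a \<in> A" for a
    unfolding r_def by (rule someI[of _ a]) (use that zero in auto)
  have eq: "r a = r b" if "a - b \<in> A'" for a b
  proof -
    have "a - c \<in> A' \<longleftrightarrow> b - c \<in> A'" for c
    proof -
      have "a - c = (a - b) + (b - c)" "b - c = (a - c) - (a - b)" by simp_all
      then show ?thesis using add[OF that] diff[OF _ that] by metis
    qed
    then show ?thesis by (simp add: r_def)
  qed
  obtain T where T: "finite T" "\<And>a. a \<in> A \<Longrightarrow> \<exists>t\<in>T. a - t \<in> A'"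
    using cov by (auto simp: finitely_covered_def)
  have "r ` A \<subseteq> r ` T" using T(2) eq by blast
  then have "finite (r ` A)" using T(1) finite_surj by blast
  then show ?thesis using r eq by blast
qed

locale heisenberg_lattice_rep = heisenberg_lattice sW Bs \<omega> \<psi> n e f A + heisenberg_rep sW Bs \<omega> \<psi> sS \<rho>
  for sW :: "'f::field \<Rightarrow> 'w::ab_group_add \<Rightarrow> 'w" and Bs \<omega> and \<psi> :: "'f \<Rightarrow> 'r::field"
    and n e f A and sS :: "'r \<Rightarrow> 's::ab_group_add \<Rightarrow> 's" and \<rho>
begin

definition R :: "'w \<Rightarrow> 's \<Rightarrow> 's" where
  "R l v = sS (\<kappa> l) (\<rho> (l, 0) v)"

lemma eigen_iff: "eigen L \<kappa> v \<longleftrightarrow> (\<forall>l\<in>L. R l v = v)"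
  by (simp add: eigen_def R_def)

lemma R_R:
  assumes "l \<in> L" "m \<in> L"
  shows "R l (R m v) = R (l + m) v"
proof -
  have "R l (R m v) = sS (\<kappa> l * \<kappa> m) (\<rho> (l + m, \<omega> l m / 2) v)"
    by (simp add: R_def rep_scale rep_mult mult.commute)
  also have "\<dots> = R (l + m) v"
    by (subst rep_decompose) (simp add: R_def \<kappa>_add[OF assms])
  finally show ?thesis .
qed

lemma R_rep: "R l (\<rho> (w, t) v) = sS (\<psi> (\<omega> l w)) (\<rho> (w, t) (R l v))"
  by (simp add: R_def rep_commute rep_scale mult.commute)

lemma R_sum: "R l (sum g I) = (\<Sum>i\<in>I. R l (g i))"
  by (simp add: R_def rep_sum V.scale_sum_right)

text \<open>The averages over \<open>L\<close> of the translates \<open>\<rho> (w, 0) v\<close> cannot all vanish, since the characters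
  \<open>\<lambda>w. \<psi> (\<omega> t w)\<close> attached to distinct cosets \<open>t\<close> are linearly independent.\<close>

lemma eigen_exists_of_fixed:
  assumes v: "v \<noteq> 0" and A': "A' \<subseteq> A" "annih (annih A') = A'" "finitely_covered A A'"
    and B': "B' \<subseteq> annih A" "annih (annih B') = B'" "finitely_covered (annih A) B'"
    and fixed: "\<And>l. l \<in> lat A' B' \<Longrightarrow> R l v = v"
  shows "\<exists>u. u \<noteq> 0 \<and> eigen L \<kappa> u"
proof (rule ccontr)
  assume none: "\<nexists>u. u \<noteq> 0 \<and> eigen L \<kappa> u"
  define L' where "L' = lat A' B'"
  \<comment> \<open>For \<open>w\<close> in \<open>G\<close> the vector
    \<open>\<rho> (w, 0) v\<close> is still fixed by \<open>L'\<close> (\<open>lat_pairing\<close>),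
    and \<open>G\<close> separates the cosets of \<open>L'\<close>
    (\<open>lat_separate\<close>).\<close>
  define G where "G = lat (annih B') (annih A')"
  have L'L: "L' \<subseteq> L" unfolding L'_def L_def by (rule lat_mono[OF A'(1) B'(1)])
  have L'_add: "x + y \<in> L'" if "x \<in> L'" "y \<in> L'" for x y
    using that lat_annih_add[of x "annih A'" "annih B'" y] by (simp add: L'_def A' B')
  have L'_minus: "- x \<in> L'" if "x \<in> L'" for x
    using that lat_annih_minus[of x "annih A'" "annih B'"] by (simp add: L'_def A' B')
  have L'0: "0 \<in> L'"
    using lat_annih_zero[of "annih A'" "annih B'"] by (simp add: L'_def A' B')
  have covered: "finitely_covered L L'"
    unfolding L_def L'_def by (rule finitely_covered_lat[OF A'(3) B'(3)])
  obtain r where r0: "finite (r ` L) \<and> (\<forall>a\<in>L. r a \<in> L \<and> a - r a \<in> L') \<and>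
      (\<forall>a\<in>L. \<forall>b\<in>L. a - b \<in> L' \<longrightarrow> r a = r b)"
    using transversal_exists[OF covered L'_add L'_minus L'0] ..
  then have fin: "finite (r ` L)" by blast
  from r0 have r: "r a \<in> L" "a - r a \<in> L'" and r_eq: "b \<in> L \<Longrightarrow> a - b \<in> L' \<Longrightarrow> r a = r b"
    if "a \<in> L" for a b using that by blast+
  let ?T = "r ` L"
  have TL: "t \<in> L" if "t \<in> ?T" for t using that r(1) by blast
  have rr: "r t = t" if "t \<in> ?T" for t
  proof -
    obtain a where a: "a \<in> L" "t = r a" using \<open>t \<in> ?T\<close> by blast
    have "r a = r (r a)" by (rule r_eq[OF a(1) r(1)[OF a(1)] r(2)[OF a(1)]])
    then show ?thesis using a by simp
  qed
  have distinct: "\<exists>w\<in>G. \<psi> (\<omega> t w) \<noteq> \<psi> (\<omega> u w)" if "t \<in> ?T" "u \<in> ?T" "t \<noteq> u" for t u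
  proof -
    have "t - u \<notin> L'" using r_eq[OF TL[OF that(1)] TL[OF that(2)]] rr[OF that(1)] rr[OF that(2)] that(3) by force
    then obtain w where "w \<in> G" "\<psi> (\<omega> (t - u) w) \<noteq> 1"
      using lat_separate[OF A'(2) B'(2)] unfolding L'_def G_def by blast
    then show ?thesis by (intro bexI[of _ w]) (simp_all add: form_diff_left char_diff)
  qed
  have avg: "(\<Sum>t\<in>?T. sS (\<psi> (\<omega> t w)) (R t v)) = 0" if w: "w \<in> G" for w
  proof -
    define x where "x = \<rho> (w, 0) v"
    \<comment> \<open>An average over the cosets of \<open>L'\<close>, without division by their
      number. It is fixed by \<open>L\<close> because translation by \<open>l\<close> permutes the
      cosets.\<close>
    define u where "u = (\<Sum>t\<in>?T. R t x)"
    have x: "R d x = x" if "d \<in> L'" for d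
      using that w lat_pairing[of d A' B' w] fixed by (simp add: x_def R_rep L'_def G_def)
    have R_r: "R (r a) x = R a x" if a: "a \<in> L" for a
    proof -
      have "R a x = R (r a + (a - r a)) x" by simp
      also have "\<dots> = R (r a) (R (a - r a) x)" using r[OF a] L'L by (intro R_R[symmetric]) auto
      finally show ?thesis using x r(2)[OF a] by simp
    qed
    have "R l u = u" if l: "l \<in> L" for l
    proof -
      have "R l u = (\<Sum>t\<in>?T. R (r (l + t)) x)"
        unfolding u_def R_sum
      proof (rule sum.cong[OF refl])
        fix t assume "t \<in> ?T"
        then have t: "t \<in> L" by (rule TL)
        show "R l (R t x) = R (r (l + t)) x" by (simp only: R_R[OF l t] R_r[OF L_add[OF l t]])
      qed
      also have "\<dots> = (\<Sum>t\<in>?T. R t x)"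
      proof (rule sum.reindex_bij_witness[of _ "\<lambda>t. r (t - l)" "\<lambda>t. r (l + t)"])
        have L_diff: "a - l \<in> L" if "a \<in> L" for a using L_add[OF that L_minus[OF l]] by simp
        fix t assume t: "t \<in> ?T"
        have lt: "l + t \<in> L" "t - l \<in> L" "t \<in> L"
          using L_add[OF l TL[OF t]] L_diff[OF TL[OF t]] TL[OF t] by auto
        show "r (l + t) \<in> ?T" "r (t - l) \<in> ?T" by (rule imageI[OF lt(1)], rule imageI[OF lt(2)])
        have "t - (r (l + t) - l) \<in> L'" using r(2)[OF lt(1)] by (simp add: algebra_simps)
        then have "r t = r (r (l + t) - l)" by (rule r_eq[OF lt(3) L_diff[OF r(1)[OF lt(1)]]])
        then show "r (r (l + t) - l) = t" using rr[OF t] by (simp only:)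
        have "t - (l + r (t - l)) \<in> L'" using r(2)[OF lt(2)] by (simp add: algebra_simps)
        then have "r t = r (l + r (t - l))" by (rule r_eq[OF lt(3) L_add[OF l r(1)[OF lt(2)]]])
        then show "r (l + r (t - l)) = t" using rr[OF t] by (simp only:)
      qed simp
      finally show ?thesis by (simp add: u_def)
    qed
    then have "u = 0" using none unfolding eigen_iff by blast
    \<comment> \<open>Moving \<open>\<rho> (w, 0)\<close> to the front turns the vanishing of
      \<open>u\<close> into a linear relation between characters on \<open>G\<close>.\<close>
    moreover have "u = \<rho> (w, 0) (\<Sum>t\<in>?T. sS (\<psi> (\<omega> t w)) (R t v))"
      by (simp add: u_def x_def R_rep rep_sum rep_scale)
    ultimately show ?thesis by (metis rep_inverse rep_zero)
  qed
  have G: "0 \<in> G" "\<And>x y. x \<in> G \<Longrightarrow> y \<in> G \<Longrightarrow> x + y \<in> G"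
    unfolding G_def by (rule lat_annih_zero lat_annih_add; assumption?)+
  \<comment> \<open>Independence kills every coefficient \<open>R t v\<close>. The representative of
    the zero coset is one at hand, and its operator is invertible, which forces
    \<open>v = 0\<close>.\<close>
  have r0: "r 0 \<in> ?T" using L_zero by simp
  have "R (r 0) v = 0"
  proof (rule V.dedekind_independence[where \<eta> = "\<lambda>t w. \<psi> (\<omega> t w)" and T = ?T and G = G])
    show "\<exists>w\<in>G. \<psi> (\<omega> t w) \<noteq> \<psi> (\<omega> u w)" if "t \<in> ?T" "u \<in> ?T" "t \<noteq> u" for t u
      using that by (rule distinct)
    show "(\<Sum>t\<in>?T. sS (\<psi> (\<omega> t w)) (R t v)) = 0" if "w \<in> G" for w
      using that by (rule avg)
  qed (simp_all add: fin r0 G form_add_right char_add)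
  then have "\<rho> (r 0, 0) v = 0" by (simp add: R_def)
  then have "v = 0" by (metis rep_inverse rep_zero)
  then show False using v by simp
qed

end

section \<open>Irreducibility and Schur's lemma\<close>

context heisenberg_rep
begin

definition irreducible :: bool where
  "irreducible \<longleftrightarrow> (\<forall>U. V.subspace U \<and> (\<forall>h. \<rho> h ` U \<subseteq> U) \<longrightarrow> U = {0} \<or> U = UNIV)"

lemma irreducibleD:
  assumes "irreducible" "V.subspace U" "\<And>h x. x \<in> U \<Longrightarrow> \<rho> h x \<in> U" "u \<in> U" "u \<noteq> 0"
  shows "U = UNIV"
proof -
  have "\<forall>h. \<rho> h ` U \<subseteq> U" using assms(3) by blast
  then have "U = {0} \<or> U = UNIV" using assms(1,2) unfolding irreducible_def by blast
  then show ?thesis using assms(4,5) by blast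
qed

lemma span_orbit_UNIV:
  assumes "irreducible" "v \<noteq> 0"
  shows "V.span (range (\<lambda>h. \<rho> h v)) = UNIV"
  by (rule irreducibleD[OF assms(1) _ _ span_orbit_self assms(2)]) (simp_all add: rep_span_orbit)

text \<open>\<open>T\<close> preserves the line of vectors of type \<open>(L, \<kappa>)\<close>, so
  \<open>v\<close> is an eigenvector; its eigenspace is invariant, hence everything. The eigenvalue
  comes from this line and not from an algebraically closed field.\<close>

lemma schur_of_eigen:
  assumes irr: "irreducible" and v: "eigen L \<kappa> v" "v \<noteq> 0"
    and nz: "\<And>l. l \<in> L \<Longrightarrow> \<kappa> l \<noteq> 0"
    and sep: "\<And>w. w \<notin> L \<Longrightarrow> \<exists>l\<in>L. \<psi> (\<omega> l w) \<noteq> 1"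
    and T: "Vector_Spaces.linear sS sS T" and comm: "\<And>h x. T (\<rho> h x) = \<rho> h (T x)"
  shows "\<exists>c. T = sS c"
proof -
  have T_add: "T (x + y) = T x + T y" and T_scale: "T (sS c x) = sS c (T x)" for x y c
    using T by (auto simp: Vector_Spaces.linear_iff)
  have eigen_T: "eigen L \<kappa> (T v)"
    unfolding eigen_def
  proof
    fix l assume "l \<in> L"
    then have "T (sS (\<kappa> l) (\<rho> (l, 0) v)) = T v" using v(1) by (simp add: eigen_def)
    then show "sS (\<kappa> l) (\<rho> (l, 0) (T v)) = T v" by (simp only: T_scale comm)
  qed
  have span_T: "T v \<in> V.span (range (\<lambda>h. \<rho> h v))" by (simp add: span_orbit_UNIV[OF irr v(2)])
  have "\<exists>c. T v = sS c v"
    by (rule eigen_unique[where L = L and \<kappa> = \<kappa>]) (fact nz sep v(1) eigen_T span_T)+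
  then obtain c where c: "T v = sS c v" ..
  have "T x = sS c x" for x
  proof -
    have "{x. T x = sS c x} = UNIV"
    proof (rule irreducibleD[OF irr _ _ _ v(2)])
      have "T 0 = 0" using T_scale[of 0 0] by simp
      then show "V.subspace {x. T x = sS c x}"
        by (simp add: V.subspace_def T_add T_scale V.scale_right_distrib V.scale_left_commute)
    qed (simp_all add: c comm rep_scale)
    then show ?thesis by blast
  qed
  then show ?thesis by blast
qed

end

context heisenberg_lattice_rep
begin

text \<open>Smoothness gives a neighbourhood of zero stabilising \<open>v\<close>. Small
  \<open>A'\<close> and \<open>B'\<close> put \<open>lat A' B'\<close> inside it and where
  \<open>\<kappa>\<close> is 1, so the averaging argument applies.\<close>

lemma eigen_exists:
  assumes abs: "nonarch_absolute_value absF" and char: "openin (field_topology absF) {x. \<psi> x = 1}"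
    and A: "has_small_subgroups absF A"
    and smooth: "openin (heisenberg_topology absF sW) {h. \<rho> h v = v}" and v: "v \<noteq> 0"
  shows "\<exists>u. u \<noteq> 0 \<and> eigen L \<kappa> u"
proof -
  have nhds: "\<forall>x y. (x, y) \<in> {h. \<rho> h v = v} \<longrightarrow> (\<exists>U T. openin (vector_topology absF sW) U \<and>
      openin (field_topology absF) T \<and> x \<in> U \<and> y \<in> T \<and> U \<times> T \<subseteq> {h. \<rho> h v = v})"
    using smooth unfolding heisenberg_topology_def openin_prod_topology_alt .
  have "(0, 0) \<in> {h. \<rho> h v = v}" by simp
  from nhds[rule_format, OF this]
  obtain U T where U: "openin (vector_topology absF sW) U" "0 \<in> U" and T: "0 \<in> T"
    and UT: "U \<times> T \<subseteq> {h. \<rho> h v = v}" by (elim exE conjE) (rule that)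
  obtain \<delta> where \<delta>: "\<delta> > 0" "\<forall>w\<in>lat {x. absF x \<le> \<delta>} {x. absF x \<le> \<delta>}. w \<in> U"
    using vector_topology_nhds_0[OF abs U] by (elim exE conjE) (rule that)
  obtain \<epsilon> where \<epsilon>: "\<epsilon> > 0" "\<forall>w\<in>lat {x. absF x \<le> \<epsilon>} {x. absF x \<le> \<epsilon>}. \<kappa> w = 1"
    using \<kappa>_eq_1_near_0[OF abs char] by (elim exE conjE) (rule that)
  have "min \<delta> \<epsilon> > 0" using \<delta>(1) \<epsilon>(1) by simp
  from A[unfolded has_small_subgroups_def, rule_format, OF this] obtain A' B' where AB: "A' \<subseteq> A" "B' \<subseteq> annih A" "annih (annih A') = A'" "annih (annih B') = B'"
    "finitely_covered A A'" "finitely_covered (annih A) B'" and small: "\<forall>x\<in>A' \<union> B'. absF x \<le> min \<delta> \<epsilon>"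
    by (elim exE conjE) (rule that)
  show ?thesis
  proof (rule eigen_exists_of_fixed[OF v AB(1,3,5) AB(2,4,6)])
    fix l assume l: "l \<in> lat A' B'"
    have "absF x \<le> \<delta>" "absF x \<le> \<epsilon>" if "x \<in> A' \<union> B'" for x
      using small[rule_format, OF that] by simp_all
    then have "A' \<subseteq> {x. absF x \<le> \<delta>}" "B' \<subseteq> {x. absF x \<le> \<delta>}" "A' \<subseteq> {x. absF x \<le> \<epsilon>}" "B' \<subseteq> {x. absF x \<le> \<epsilon>}"
      by blast+
    then have "l \<in> lat {x. absF x \<le> \<delta>} {x. absF x \<le> \<delta>}" "l \<in> lat {x. absF x \<le> \<epsilon>} {x. absF x \<le> \<epsilon>}"
      using l lat_mono by (meson subsetD)+
    then have "l \<in> U" and \<kappa>: "\<kappa> l = 1" using \<delta>(2) \<epsilon>(2) by simp_all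
    then have "(l, 0) \<in> {h. \<rho> h v = v}" using T UT by blast
    then show "R l v = v" by (simp add: R_def \<kappa>)
  qed
qed

end

subsection \<open>The Stone-von Neumann theorem\<close>

text \<open>The subrepresentation of \<open>S \<times> S'\<close> generated by a pair \<open>(v, v')\<close> of vectors of type \<open>(L, \<kappa>)\<close>
  contains neither \<open>(0, v')\<close> nor \<open>(v, 0)\<close>, because its vectors of that type are the multiples of \<open>(v, v')\<close>. By
  irreducibility it is the graph of an isomorphism.\<close>

lemma rep_iso_of_eigen:
  fixes sS :: "'r::field \<Rightarrow> 's::ab_group_add \<Rightarrow> 's" and sS' :: "'r \<Rightarrow> 't::ab_group_add \<Rightarrow> 't"
  assumes "heisenberg_rep sW Bs \<omega> \<psi> sS \<rho>" "heisenberg_rep sW Bs \<omega> \<psi> sS' \<rho>'"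
    and irr: "heisenberg_rep.irreducible sS \<rho>" "heisenberg_rep.irreducible sS' \<rho>'"
    and v: "heisenberg_rep.eigen sS \<rho> L \<kappa> v" "v \<noteq> 0"
    and v': "heisenberg_rep.eigen sS' \<rho>' L \<kappa> v'" "v' \<noteq> 0"
    and nz: "\<And>l. l \<in> L \<Longrightarrow> \<kappa> l \<noteq> 0"
    and sep: "\<And>w. w \<notin> L \<Longrightarrow> \<exists>l\<in>L. \<psi> (\<omega> l w) \<noteq> 1"
  shows "\<exists>\<phi>. rep_iso sS \<rho> sS' \<rho>' \<phi>"
proof -
  interpret S: heisenberg_rep sW Bs \<omega> \<psi> sS \<rho> by (rule assms)
  interpret S': heisenberg_rep sW Bs \<omega> \<psi> sS' \<rho>' by (rule assms)
  define sP where "sP = (\<lambda>c (x, y). (sS c x, sS' c y))"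
  define \<rho>P where "\<rho>P = (\<lambda>h (x, y). (\<rho> h x, \<rho>' h y))"
  have sP [simp]: "sP c (x, y) = (sS c x, sS' c y)" and \<rho>P [simp]: "\<rho>P h (x, y) = (\<rho> h x, \<rho>' h y)"
    for c x y h by (simp_all add: sP_def \<rho>P_def)
  have "vector_space sP"
    by unfold_locales (auto simp: S.V.scale_right_distrib S'.V.scale_right_distrib
        S.V.scale_left_distrib S'.V.scale_left_distrib)
  then interpret P: heisenberg_rep sW Bs \<omega> \<psi> sP \<rho>P
    by (intro heisenberg_rep.intro S.heisenberg_form_axioms heisenberg_rep_axioms.intro)
      (auto simp: Vector_Spaces.linear_iff S.rep_add S'.rep_add S.rep_scale S'.rep_scale
        S.rep_mult S'.rep_mult S.rep_central S'.rep_central)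
  define D where "D = P.V.span (range (\<lambda>h. \<rho>P h (v, v')))"
  have D_add: "(x + x', y + y') \<in> D" if "(x, y) \<in> D" "(x', y') \<in> D" for x y x' y'
    using P.V.span_add[of "(x, y)" _ "(x', y')"] that by (simp add: D_def)
  have D_scale: "(sS c x, sS' c y) \<in> D" if "(x, y) \<in> D" for c x y
    using P.V.span_scale[of "(x, y)" _ c] that by (simp add: D_def)
  have D_rep: "(\<rho> h x, \<rho>' h y) \<in> D" if "(x, y) \<in> D" for h x y
    using P.rep_span_orbit[of "(x, y)" "(v, v')" h] that by (simp add: D_def)
  have D_v: "(v, v') \<in> D" unfolding D_def by (rule P.span_orbit_self)
  have D_0: "(0, 0) \<in> D" using D_scale[OF D_v, of 0] by simp
  have eig: "P.eigen L \<kappa> (v, v')" "P.eigen L \<kappa> (0, v')" "P.eigen L \<kappa> (v, 0)"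
    using v(1) v'(1) by (auto simp: P.eigen_def S.eigen_def S'.eigen_def)
  have multiple: "\<exists>c. u = sP c (v, v')" if "P.eigen L \<kappa> u" "u \<in> D" for u
    using P.eigen_unique[OF nz sep eig(1)] that unfolding D_def by blast
  have not_D: "(0, v') \<notin> D" "(v, 0) \<notin> D"
    using multiple[OF eig(2)] multiple[OF eig(3)] v(2) v'(2) by auto
  \<comment> \<open>The fibre of \<open>D\<close> over 0 is an invariant subspace; if nonzero it
    would be everything and contain the excluded vector \<open>v'\<close>.\<close>
  have fst_unique: "y = y'" if "(x, y) \<in> D" "(x, y') \<in> D" for x y y'
  proof (rule ccontr)
    assume ne: "y \<noteq> y'"
    have "(0, y - y') \<in> D" using D_add[OF that(1) D_scale[OF that(2), of "- 1"]] by simp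
    moreover have "S'.V.subspace {y. (0, y) \<in> D}"
      using D_0 D_add[of 0 _ 0] D_scale[of 0] by (auto simp: S'.V.subspace_def)
    moreover have "\<rho>' h y \<in> {y. (0, y) \<in> D}" if "y \<in> {y. (0, y) \<in> D}" for h y
      using D_rep[of 0 y h] that by simp
    ultimately have "{y. (0, y) \<in> D} = UNIV"
      using ne by (intro S'.irreducibleD[OF irr(2), of _ "y - y'"]) auto
    then show False using not_D by auto
  qed
  have snd_unique: "x = x'" if "(x, y) \<in> D" "(x', y) \<in> D" for x x' y
  proof (rule ccontr)
    assume ne: "x \<noteq> x'"
    have "(x - x', 0) \<in> D" using D_add[OF that(1) D_scale[OF that(2), of "- 1"]] by simp
    moreover have "S.V.subspace {x. (x, 0) \<in> D}"
      using D_0 D_add[of _ 0 _ 0] D_scale[of _ 0] by (auto simp: S.V.subspace_def)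
    moreover have "\<rho> h x \<in> {x. (x, 0) \<in> D}" if "x \<in> {x. (x, 0) \<in> D}" for h x
      using D_rep[of x 0 h] that by simp
    ultimately have "{x. (x, 0) \<in> D} = UNIV"
      using ne by (intro S.irreducibleD[OF irr(1), of _ "x - x'"]) auto
    then show False using not_D by auto
  qed
  \<comment> \<open>Both projections of \<open>D\<close> are nonzero invariant subspaces, hence
    surjective.\<close>
  have "{x. \<exists>y. (x, y) \<in> D} = UNIV"
  proof (rule S.irreducibleD[OF irr(1) _ _ _ v(2)])
    show "S.V.subspace {x. \<exists>y. (x, y) \<in> D}"
      using D_0 D_add D_scale unfolding S.V.subspace_def by blast
  qed (use D_rep D_v in blast)+
  then have fst_ex: "\<exists>y. (x, y) \<in> D" for x by blast
  have "{y. \<exists>x. (x, y) \<in> D} = UNIV"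
  proof (rule S'.irreducibleD[OF irr(2) _ _ _ v'(2)])
    show "S'.V.subspace {y. \<exists>x. (x, y) \<in> D}"
      using D_0 D_add D_scale unfolding S'.V.subspace_def by blast
  qed (use D_rep D_v in blast)+
  then have snd_ex: "\<exists>x. (x, y) \<in> D" for y by blast
  obtain \<phi> where \<phi>: "\<And>x. (x, \<phi> x) \<in> D" using fst_ex by metis
  have \<phi>_eq: "\<phi> x = y" if "(x, y) \<in> D" for x y using fst_unique[OF \<phi> that] .
  have "Vector_Spaces.linear sS sS' \<phi>"
    unfolding Vector_Spaces.linear_iff
    using S.V.vector_space_axioms S'.V.vector_space_axioms D_add[OF \<phi> \<phi>] D_scale[OF \<phi>] \<phi>_eq by blast
  moreover have "bij \<phi>"
    unfolding bij_def inj_def surj_def using snd_unique snd_ex \<phi> \<phi>_eq by metis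
  moreover have "\<phi> \<circ> \<rho> h = \<rho>' h \<circ> \<phi>" for h
    unfolding comp_def by (rule ext) (rule \<phi>_eq[OF D_rep[OF \<phi>]])
  ultimately show ?thesis unfolding rep_iso_def by blast
qed

lemma (in heisenberg_form) heisenberg_rep_of_model:
  assumes "heisenberg_model absF sW \<omega> \<psi> sS \<rho>"
  shows "heisenberg_rep sW Bs \<omega> \<psi> sS \<rho>" and "heisenberg_rep.irreducible sS \<rho>"
proof -
  have V: "vector_space sS" and hom: "\<rho> \<in> hom (heisenberg \<omega>) (GL sS)"
    and irr: "\<forall>V. module.subspace sS V \<and> (\<forall>h. \<rho> h ` V \<subseteq> V) \<longrightarrow> V = {0} \<or> V = UNIV"
    and central: "\<forall>t v. \<rho> (0, t) v = sS (\<psi> t) v"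
    using assms by (simp_all add: heisenberg_model_def)
  have linear: "Vector_Spaces.linear sS sS (\<rho> h)" for h
    using hom by (auto simp: hom_def GL_def heisenberg_def)
  have mult: "\<rho> (w, t) (\<rho> (w', t') v) = \<rho> (w + w', t + t' + \<omega> w w' / 2) v" for w t w' t' v
    using hom by (simp add: hom_def GL_def heisenberg_def fun_eq_iff)
  show "heisenberg_rep sW Bs \<omega> \<psi> sS \<rho>"
    by (intro heisenberg_rep.intro heisenberg_form_axioms V heisenberg_rep_axioms.intro linear mult)
      (simp add: central)
  then interpret heisenberg_rep sW Bs \<omega> \<psi> sS \<rho> .
  show irreducible unfolding irreducible_def using irr by blast
qed

locale heisenberg_base_field = heisenberg_form sW Bs \<omega> \<psi> + smooth_character_field \<psi> absF p
  for sW :: "'f::field \<Rightarrow> 'w::ab_group_add \<Rightarrow> 'w" and Bs \<omega> and \<psi> :: "'f \<Rightarrow> 'r::field"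
    and absF :: "'f \<Rightarrow> real" and p :: nat
begin

lemma lattice_exists:
  "\<exists>n e f A. heisenberg_lattice sW Bs \<omega> \<psi> n e f A \<and> has_small_subgroups absF A"
proof -
  obtain n e f where nef: "hyperbolic_system n e f"
      "\<And>w. w = (\<Sum>i<n. sW (\<omega> w (f i)) (e i) + sW (\<omega> (e i) w) (f i))"
    using hyperbolic_basis_exists by blast
  obtain A where A: "annih (annih A) = A" "has_small_subgroups absF A"
    using dual_subgroups_exist by blast
  have "heisenberg_lattice sW Bs \<omega> \<psi> n e f A"
    by (intro heisenberg_lattice.intro heisenberg_form_axioms heisenberg_lattice_axioms.intro nef A)
  then show ?thesis using A(2) by blast
qed

lemma model_eigen_exists:
  fixes sS :: "'r \<Rightarrow> 's::ab_group_add \<Rightarrow> 's"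
  assumes lattice: "heisenberg_lattice sW Bs \<omega> \<psi> n e f A" and A: "has_small_subgroups absF A"
    and model: "heisenberg_model absF sW \<omega> \<psi> sS \<rho>"
  shows "\<exists>u. u \<noteq> 0 \<and> heisenberg_rep.eigen sS \<rho> (heisenberg_lattice.L \<omega> \<psi> n e f A)
    (heisenberg_lattice.\<kappa> \<omega> \<psi> n e f) u"
proof -
  interpret heisenberg_lattice_rep sW Bs \<omega> \<psi> n e f A sS \<rho>
    by (intro heisenberg_lattice_rep.intro lattice heisenberg_rep_of_model(1)[OF model])
  have "\<exists>v::'s. v \<noteq> 0" using model by (simp only: heisenberg_model_def)
  then obtain v :: 's where v: "v \<noteq> 0" ..
  have smooth: "openin (heisenberg_topology absF sW) {h. \<rho> h v = v}"
    using model by (simp add: heisenberg_model_def)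
  show ?thesis by (rule eigen_exists[OF nonarch_absolute_value_axioms char_smooth A smooth v])
qed

text \<open>The lattice and \<open>\<kappa>\<close> are chosen before the models, so both contain
  nonzero vectors of the same type.\<close>

theorem stone_von_neumann:
  fixes sS :: "'r \<Rightarrow> 's::ab_group_add \<Rightarrow> 's" and sS' :: "'r \<Rightarrow> 't::ab_group_add \<Rightarrow> 't"
  assumes S: "heisenberg_model absF sW \<omega> \<psi> sS \<rho>" and S': "heisenberg_model absF sW \<omega> \<psi> sS' \<rho>'"
  shows "\<exists>\<phi>. rep_iso sS \<rho> sS' \<rho>' \<phi>"
proof -
  obtain n e f A where lattice: "heisenberg_lattice sW Bs \<omega> \<psi> n e f A" and A: "has_small_subgroups absF A"
    using lattice_exists by blast
  interpret heisenberg_lattice sW Bs \<omega> \<psi> n e f A by (rule lattice)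
  obtain v where v: "v \<noteq> 0" "heisenberg_rep.eigen sS \<rho> L \<kappa> v"
    using model_eigen_exists[OF lattice A S] by blast
  obtain v' where v': "v' \<noteq> 0" "heisenberg_rep.eigen sS' \<rho>' L \<kappa> v'"
    using model_eigen_exists[OF lattice A S'] by blast
  show ?thesis
    by (rule rep_iso_of_eigen[OF heisenberg_rep_of_model(1)[OF S] heisenberg_rep_of_model(1)[OF S']
          heisenberg_rep_of_model(2)[OF S] heisenberg_rep_of_model(2)[OF S'] v(2,1) v'(2,1) \<kappa>_nonzero L_separate])
qed

theorem schur:
  fixes sS :: "'r \<Rightarrow> 's::ab_group_add \<Rightarrow> 's"
  assumes S: "heisenberg_model absF sW \<omega> \<psi> sS \<rho>"
    and T: "Vector_Spaces.linear sS sS T" and comm: "\<And>h x. T (\<rho> h x) = \<rho> h (T x)"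
  shows "\<exists>c. T = sS c"
proof -
  obtain n e f A where lattice: "heisenberg_lattice sW Bs \<omega> \<psi> n e f A" and A: "has_small_subgroups absF A"
    using lattice_exists by blast
  interpret heisenberg_lattice sW Bs \<omega> \<psi> n e f A by (rule lattice)
  obtain v where v: "v \<noteq> 0" "heisenberg_rep.eigen sS \<rho> L \<kappa> v"
    using model_eigen_exists[OF lattice A S] by blast
  show ?thesis
    by (rule heisenberg_rep.schur_of_eigen[OF heisenberg_rep_of_model[OF S] v(2,1) \<kappa>_nonzero L_separate T comm])
qed

end

section \<open>The metaplectic group\<close>

lemma mult_group_simps [simp]:
  "carrier (mult_group TYPE('r::field)) = {x. x \<noteq> 0}"
  "x \<otimes>\<^bsub>mult_group TYPE('r)\<^esub> y = x * y"
  "\<one>\<^bsub>mult_group TYPE('r)\<^esub> = 1"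
  by (simp_all add: mult_group_def)

lemma comm_group_mult_group: "comm_group (mult_group TYPE('r::field))"
proof (rule comm_groupI)
  fix x :: 'r assume "x \<in> carrier (mult_group TYPE('r))"
  then show "\<exists>y\<in>carrier (mult_group TYPE('r)). y \<otimes>\<^bsub>mult_group TYPE('r)\<^esub> x = \<one>\<^bsub>mult_group TYPE('r)\<^esub>"
    by (intro bexI[of _ "inverse x"]) auto
qed auto

text \<open>Two isomorphisms of central extensions differ by a homomorphism from the quotient to the
  central kernel.\<close>

lemma central_extension_iso_unique:
  fixes A :: "('a, 'k) monoid_scheme" and E :: "('e, 'm) monoid_scheme" and E' :: "('e2, 'n) monoid_scheme"
    and G :: "('g, 'l) monoid_scheme"
  assumes E: "central_extension A i E p G" and E': "central_extension A i' E' p' G"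
    and trivial: "\<And>\<eta> g. \<eta> \<in> hom G A \<Longrightarrow> g \<in> carrier G \<Longrightarrow> \<eta> g = \<one>\<^bsub>A\<^esub>"
    and f: "central_extension_iso A i E p i' E' p' f" and f': "central_extension_iso A i E p i' E' p' f'"
    and x: "x \<in> carrier E"
  shows "f x = f' x"
proof -
  interpret E: group E using E by (simp add: central_extension_def)
  interpret E': group E' using E' by (simp add: central_extension_def)
  interpret G: group G using E by (simp add: central_extension_def)
  interpret A: group A using E by (simp add: central_extension_def)
  have i: "i \<in> hom A E" and p: "p \<in> hom E G" and kerE: "i ` carrier A = kernel E G p"
    and surj: "p ` carrier E = carrier G"
    using E by (simp_all add: central_extension_def)
  have i': "i' \<in> hom A E'" and p': "p' \<in> hom E' G" and inj: "inj_on i' (carrier A)"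
    and kerE': "i' ` carrier A = kernel E' G p'"
    and central: "\<And>a x. a \<in> carrier A \<Longrightarrow> x \<in> carrier E' \<Longrightarrow> i' a \<otimes>\<^bsub>E'\<^esub> x = x \<otimes>\<^bsub>E'\<^esub> i' a"
    using E' by (simp_all add: central_extension_def)
  interpret p: group_hom E G p using p by unfold_locales
  interpret p': group_hom E' G p' using p' by unfold_locales
  interpret i': group_hom A E' i' using i' by unfold_locales
  have homs: "f \<in> hom E E'" "f' \<in> hom E E'"
    and fi: "\<And>a. a \<in> carrier A \<Longrightarrow> f (i a) = i' a" "\<And>a. a \<in> carrier A \<Longrightarrow> f' (i a) = i' a"
    and fp: "\<And>x. x \<in> carrier E \<Longrightarrow> p' (f x) = p x" "\<And>x. x \<in> carrier E \<Longrightarrow> p' (f' x) = p x"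
    using f f' by (simp_all add: central_extension_iso_def iso_def)
  interpret f: group_hom E E' f using homs by unfold_locales
  interpret f': group_hom E E' f' using homs by unfold_locales
  \<comment> \<open>The quotient of \<open>f\<close> and \<open>f'\<close> takes values in the
    central image of \<open>A\<close>, so it is multiplicative. It is trivial on \<open>i a\<close>,
    where \<open>f\<close> and \<open>f'\<close> agree, hence constant on the fibres of
    \<open>p\<close>.\<close>
  define d where "d x = f x \<otimes>\<^bsub>E'\<^esub> inv\<^bsub>E'\<^esub> f' x" for x
  have d_closed: "d x \<in> carrier E'" if "x \<in> carrier E" for x using that by (simp add: d_def)
  have "d x \<in> kernel E' G p'" if "x \<in> carrier E" for x
    using that d_closed[OF that] by (simp add: kernel_def d_def fp)
  then have d_ker: "\<exists>a\<in>carrier A. d x = i' a" if "x \<in> carrier E" for x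
    using that kerE' by blast
  have d_central: "d y \<otimes>\<^bsub>E'\<^esub> z = z \<otimes>\<^bsub>E'\<^esub> d y" if "y \<in> carrier E" "z \<in> carrier E'" for y z
    using d_ker[OF that(1)] central[OF _ that(2)] by metis
  have d_mult: "d (x \<otimes>\<^bsub>E\<^esub> y) = d x \<otimes>\<^bsub>E'\<^esub> d y" if x: "x \<in> carrier E" and y: "y \<in> carrier E" for x y
  proof -
    have "d (x \<otimes>\<^bsub>E\<^esub> y) = f x \<otimes>\<^bsub>E'\<^esub> (d y \<otimes>\<^bsub>E'\<^esub> inv\<^bsub>E'\<^esub> f' x)"
      using x y by (simp add: d_def E'.inv_mult_group E'.m_assoc)
    also have "\<dots> = f x \<otimes>\<^bsub>E'\<^esub> (inv\<^bsub>E'\<^esub> f' x \<otimes>\<^bsub>E'\<^esub> d y)"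
      using x d_central[OF y] by simp
    finally show ?thesis using x y d_closed[OF y] by (simp add: d_def E'.m_assoc)
  qed
  have d_i: "d (i a) = \<one>\<^bsub>E'\<^esub>" if "a \<in> carrier A" for a
    using that by (simp add: d_def fi)
  have d_eq: "d x = d y" if x: "x \<in> carrier E" and y: "y \<in> carrier E" and "p x = p y" for x y
  proof -
    have "inv\<^bsub>E\<^esub> y \<otimes>\<^bsub>E\<^esub> x \<in> kernel E G p" using that by (simp add: kernel_def)
    then obtain a where a: "a \<in> carrier A" "inv\<^bsub>E\<^esub> y \<otimes>\<^bsub>E\<^esub> x = i a" using kerE by (metis imageE)
    have ia: "i a \<in> carrier E" using i a by (auto simp: hom_def)
    have "x = y \<otimes>\<^bsub>E\<^esub> i a" using x y a(2)[symmetric] by (simp add: E.m_assoc[symmetric])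
    then have "d x = d y \<otimes>\<^bsub>E'\<^esub> d (i a)" using d_mult[OF y ia] by simp
    then show ?thesis using d_i[OF a(1)] d_closed[OF y] by simp
  qed
  \<comment> \<open>A set-theoretic section; since \<open>d\<close> is constant on fibres,
    \<open>\<eta>\<close> is a homomorphism although \<open>s\<close> need not be.\<close>
  define s where "s g = (SOME x. x \<in> carrier E \<and> p x = g)" for g
  have s: "s g \<in> carrier E" "p (s g) = g" if "g \<in> carrier G" for g
  proof -
    have "\<exists>x. x \<in> carrier E \<and> p x = g" using surj that by (metis imageE)
    then have "s g \<in> carrier E \<and> p (s g) = g" unfolding s_def by (rule someI_ex)
    then show "s g \<in> carrier E" "p (s g) = g" by simp_all
  qed
  define \<eta> where "\<eta> g = inv_into (carrier A) i' (d (s g))" for g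
  have \<eta>: "\<eta> g \<in> carrier A" "i' (\<eta> g) = d (s g)" if "g \<in> carrier G" for g
  proof -
    have "d (s g) \<in> i' ` carrier A" using d_ker[OF s(1)[OF that]] by (metis image_eqI)
    then show "\<eta> g \<in> carrier A" "i' (\<eta> g) = d (s g)"
      unfolding \<eta>_def by (rule inv_into_into, rule f_inv_into_f)
  qed
  have "\<eta> \<in> hom G A"
  proof (rule homI)
    fix g h assume g: "g \<in> carrier G" and h: "h \<in> carrier G"
    have "i' (\<eta> (g \<otimes>\<^bsub>G\<^esub> h)) = d (s (g \<otimes>\<^bsub>G\<^esub> h))" using g h by (simp add: \<eta>)
    also have "\<dots> = d (s g \<otimes>\<^bsub>E\<^esub> s h)" using g h s by (intro d_eq) simp_all
    also have "\<dots> = i' (\<eta> g \<otimes>\<^bsub>A\<^esub> \<eta> h)" using g h by (simp add: d_mult s \<eta>)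
    finally show "\<eta> (g \<otimes>\<^bsub>G\<^esub> h) = \<eta> g \<otimes>\<^bsub>A\<^esub> \<eta> h"
      by (rule inj_onD[OF inj]) (simp_all add: \<eta>(1) g h)
  qed (rule \<eta>)
  then have "\<eta> (p x) = \<one>\<^bsub>A\<^esub>" using x by (intro trivial) simp_all
  then have "d (s (p x)) = \<one>\<^bsub>E'\<^esub>" using \<eta>(2)[of "p x"] x by simp
  then have "d x = \<one>\<^bsub>E'\<^esub>" using d_eq[of x "s (p x)"] s[of "p x"] x by simp
  then have "f x = inv\<^bsub>E'\<^esub> (inv\<^bsub>E'\<^esub> f' x)"
    using x unfolding d_def by (intro E'.inv_equality[symmetric]) simp_all
  then show ?thesis using x by simp
qed

lemma GL_simps [simp]:
  "M \<in> carrier (GL sS) \<longleftrightarrow> Vector_Spaces.linear sS sS M \<and> bij M"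
  "M \<otimes>\<^bsub>GL sS\<^esub> N = M \<circ> N" "\<one>\<^bsub>GL sS\<^esub> = id"
  by (simp_all add: GL_def)

lemma linear_inv_into:
  assumes "Vector_Spaces.linear s1 s2 M" "bij M"
  shows "Vector_Spaces.linear s2 s1 (inv_into UNIV M)"
proof -
  have MM: "M (inv_into UNIV M x) = x" "inv_into UNIV M (M y) = y" for x y
    using assms(2) by (simp_all add: bij_is_surj surj_f_inv_f bij_is_inj)
  then have "inv_into UNIV M z = y \<longleftrightarrow> z = M y" for y z by metis
  then show ?thesis using assms(1) by (simp add: Vector_Spaces.linear_iff MM)
qed

lemma linear_comp:
  "Vector_Spaces.linear s1 s2 M \<Longrightarrow> Vector_Spaces.linear s2 s3 N \<Longrightarrow> Vector_Spaces.linear s1 s3 (N \<circ> M)"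
  by (simp add: Vector_Spaces.linear_iff)

lemma to_PGL_eq: "to_PGL sS M = {sS c \<circ> M | c. c \<noteq> 0}"
  by (auto simp: to_PGL_def r_coset_def scalars_def)

text \<open>Substituting \<open>g w\<close> for \<open>w\<close> and composing with \<open>M\<close>
  removes both inverses from the definition.\<close>

lemma (in symplectic) intertwines_iff:
  assumes g: "g \<in> carrier (Sp sW \<omega>)"
  shows "intertwines sS \<rho> g M \<longleftrightarrow> Vector_Spaces.linear sS sS M \<and> bij M \<and>
    (\<forall>w t v. M (\<rho> (w, t) v) = \<rho> (g w, t) (M v))"
proof (cases "Vector_Spaces.linear sS sS M \<and> bij M")
  case True
  have bij: "bij g" using g by (simp add: Sp_iff)
  have eq: "inv_into UNIV M x = y \<longleftrightarrow> x = M y" for x y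
    using True by (metis bij_inv_eq_iff)
  have "intertwines sS \<rho> g M \<longleftrightarrow> (\<forall>w t v. \<rho> (w, t) (M v) = M (\<rho> (inv_into UNIV g w, t) v))"
    using True by (simp add: intertwines_def fun_eq_iff eq)
  also have "\<dots> \<longleftrightarrow> (\<forall>w t v. M (\<rho> (w, t) v) = \<rho> (g w, t) (M v))"
    using bij by (metis bij_inv_eq_iff)
  finally show ?thesis using True by simp
next
  case False
  then show ?thesis by (auto simp: intertwines_def)
qed

section \<open>Existence of the operators attached to symplectic automorphisms\<close>

context heisenberg_base_field
begin

text \<open>A linear form composed with \<open>g\<close> is a linear form, so the subbasis is stable
  under preimages.\<close>

lemma vector_topology_vimage:
  assumes "Vector_Spaces.linear sW sW g" "openin (vector_topology absF sW) U"
  shows "openin (vector_topology absF sW) (g -` U)"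
proof -
  let ?S = "{l -` U | l U. Vector_Spaces.linear sW (*) l \<and> openin (field_topology absF) U}"
  have "generate_topology_on ?S U"
    using assms(2) by (simp add: vector_topology_def openin_topology_generated_by_iff)
  then have "generate_topology_on ?S (g -` U)"
  proof (induction rule: generate_topology_on.induct)
    case Empty
    then show ?case by (simp add: generate_topology_on.Empty)
  next
    case (Int a b)
    then show ?case by (simp only: vimage_Int generate_topology_on.Int)
  next
    case (UN K)
    have "g -` \<Union> K = \<Union> ((\<lambda>k. g -` k) ` K)" by blast
    then show ?case using UN by (auto intro!: generate_topology_on.UN)
  next
    case (Basis s)
    then obtain l U where "s = l -` U" "Vector_Spaces.linear sW (*) l" "openin (field_topology absF) U"
      by blast
    then have "g -` s = (l \<circ> g) -` U" "Vector_Spaces.linear sW (*) (l \<circ> g)"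
      using linear_comp[OF assms(1)] by (auto simp only: vimage_comp)
    with \<open>openin (field_topology absF) U\<close> have "g -` s \<in> ?S" by blast
    then show ?case by (rule generate_topology_on.Basis)
  qed
  then show ?thesis by (simp add: vector_topology_def openin_topology_generated_by_iff)
qed

text \<open>Multiplicativity holds as \<open>g\<close> preserves \<open>\<omega>\<close>, smoothness
  as \<open>g\<close> is continuous, irreducibility as \<open>g\<close> is onto, and the central
  character is unchanged as \<open>g 0 = 0\<close>.\<close>

lemma heisenberg_model_twist:
  assumes model: "heisenberg_model absF sW \<omega> \<psi> sS \<rho>" and g: "g \<in> carrier (Sp sW \<omega>)"
  shows "heisenberg_model absF sW \<omega> \<psi> sS (\<lambda>(w, t). \<rho> (g w, t))"
proof -
  have gadd: "g (v + w) = g v + g w" and gform: "\<omega> (g v) (g w) = \<omega> v w" and bij: "bij g" for v w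
    using g by (simp_all add: Sp_iff)
  have lin: "Vector_Spaces.linear sW sW g" using g by (simp add: Sp_def)
  have g0: "g 0 = 0" using gadd[of 0 0] by simp
  have hom: "\<rho> \<in> hom (heisenberg \<omega>) (GL sS)" using model by (simp add: heisenberg_model_def)
  then have mult: "\<rho> (w + w', t + t' + \<omega> w w' / 2) = \<rho> (w, t) \<circ> \<rho> (w', t')"
    and GL: "\<rho> (w, t) \<in> carrier (GL sS)" for w t w' t'
    by (simp_all add: hom_def heisenberg_def Pi_iff)
  have "\<rho> (g (w + w'), t + t' + \<omega> w w' / 2) = \<rho> (g w, t) \<circ> \<rho> (g w', t')" for w t w' t'
    using mult[of "g w" "g w'" t t'] by (simp only: gadd gform)
  then have "(\<lambda>(w, t). \<rho> (g w, t)) \<in> hom (heisenberg \<omega>) (GL sS)"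
    using GL by (simp add: hom_def heisenberg_def Pi_iff)
  moreover have "openin (heisenberg_topology absF sW) {h. (\<lambda>(w, t). \<rho> (g w, t)) h v = v}" for v
    unfolding heisenberg_topology_def openin_prod_topology_alt
  proof (intro allI impI)
    fix w t assume "(w, t) \<in> {h. (\<lambda>(w, t). \<rho> (g w, t)) h v = v}"
    then have gw: "(g w, t) \<in> {h. \<rho> h v = v}" by simp
    have nhds: "\<forall>x y. (x, y) \<in> {h. \<rho> h v = v} \<longrightarrow> (\<exists>U T. openin (vector_topology absF sW) U \<and>
      openin (field_topology absF) T \<and> x \<in> U \<and> y \<in> T \<and> U \<times> T \<subseteq> {h. \<rho> h v = v})"
      using model unfolding heisenberg_model_def heisenberg_topology_def openin_prod_topology_alt by simp
    from nhds[rule_format, OF gw]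
    obtain U T where "openin (vector_topology absF sW) U" "openin (field_topology absF) T"
      "g w \<in> U" "t \<in> T" "U \<times> T \<subseteq> {h. \<rho> h v = v}" by (elim exE conjE) (rule that)
    then show "\<exists>U T. openin (vector_topology absF sW) U \<and> openin (field_topology absF) T \<and>
        w \<in> U \<and> t \<in> T \<and> U \<times> T \<subseteq> {h. (\<lambda>(w, t). \<rho> (g w, t)) h v = v}"
      by (intro exI[of _ "g -` U"] exI[of _ T] conjI vector_topology_vimage[OF lin]) auto
  qed
  moreover have "U = {0} \<or> U = UNIV"
    if U: "module.subspace sS U" "\<forall>h. (\<lambda>(w, t). \<rho> (g w, t)) h ` U \<subseteq> U" for U
  proof -
    have "\<rho> (w, t) ` U \<subseteq> U" for w t
    proof -
      have "\<rho> (g (inv_into UNIV g w), t) ` U \<subseteq> U"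
        using U(2)[rule_format, of "(inv_into UNIV g w, t)"] by simp
      then show ?thesis using bij by (simp add: bij_is_surj surj_f_inv_f)
    qed
    then have "\<forall>h. \<rho> h ` U \<subseteq> U" by simp
    moreover have "\<forall>V. module.subspace sS V \<and> (\<forall>h. \<rho> h ` V \<subseteq> V) \<longrightarrow> V = {0} \<or> V = UNIV"
      using model by (simp add: heisenberg_model_def)
    ultimately show ?thesis using U(1) by blast
  qed
  ultimately show ?thesis
    using model unfolding heisenberg_model_def by (simp add: g0)
qed

text \<open>An isomorphism from the model to its twist by \<open>g\<close> is exactly an operator
  for \<open>g\<close>.\<close>

lemma intertwiner_exists:
  assumes model: "heisenberg_model absF sW \<omega> \<psi> sS \<rho>" and g: "g \<in> carrier (Sp sW \<omega>)"
  shows "\<exists>M. intertwines sS \<rho> g M"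
proof -
  obtain M where "rep_iso sS \<rho> sS (\<lambda>(w, t). \<rho> (g w, t)) M"
    using stone_von_neumann[OF model heisenberg_model_twist[OF model g]] ..
  then have "intertwines sS \<rho> g M"
    by (simp add: intertwines_iff[OF g] rep_iso_def fun_eq_iff)
  then show ?thesis by blast
qed

end

section \<open>The fibre product as a central extension\<close>

context heisenberg_base_field
begin

text \<open>By Schur's lemma the operators for \<open>g\<close> form one coset of the scalars, so
  comparing classes amounts to testing a single representative.\<close>

lemma \<sigma>_eq_to_PGL_iff:
  fixes sS :: "'r \<Rightarrow> 's::ab_group_add \<Rightarrow> 's"
  assumes model: "heisenberg_model absF sW \<omega> \<psi> sS \<rho>" and g: "g \<in> carrier (Sp sW \<omega>)"
    and M: "M \<in> carrier (GL sS)"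
  shows "\<sigma> sS \<rho> g = to_PGL sS M \<longleftrightarrow> intertwines sS \<rho> g M"
proof
  interpret heisenberg_rep sW Bs \<omega> \<psi> sS \<rho> by (rule heisenberg_rep_of_model(1)[OF model])
  show "intertwines sS \<rho> g M" if "\<sigma> sS \<rho> g = to_PGL sS M"
  proof -
    have "M \<in> to_PGL sS M" by (auto simp: to_PGL_eq fun_eq_iff intro!: exI[of _ 1])
    then show ?thesis using that by (auto simp: \<sigma>_def)
  qed
  assume M_int: "intertwines sS \<rho> g M"
  then have M_lin: "Vector_Spaces.linear sS sS M" and M_bij: "bij M"
    and M_rep: "\<And>w t v. M (\<rho> (w, t) v) = \<rho> (g w, t) (M v)"
    by (simp_all add: intertwines_iff[OF g])
  have M_scale: "M (sS c v) = sS c (M v)" for c v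
    using M_lin by (simp add: Vector_Spaces.linear_iff)
  show "\<sigma> sS \<rho> g = to_PGL sS M"
  proof (intro equalityI subsetI)
    fix N assume "N \<in> \<sigma> sS \<rho> g"
    then have N_lin: "Vector_Spaces.linear sS sS N" and N_bij: "bij N"
      and N_rep: "\<And>w t v. N (\<rho> (w, t) v) = \<rho> (g w, t) (N v)"
      by (simp_all add: \<sigma>_def intertwines_iff[OF g])
    \<comment> \<open>\<open>M\<close> and \<open>N\<close> intertwine the same two representations,
      so this quotient commutes with \<open>\<rho>\<close> and is a scalar.\<close>
    define T where "T = inv_into UNIV M \<circ> N"
    have MT: "M (T v) = N v" for v using M_bij by (simp add: T_def bij_is_surj surj_f_inv_f)
    have T_lin: "Vector_Spaces.linear sS sS T"
      unfolding T_def by (rule linear_comp[OF N_lin linear_inv_into[OF M_lin M_bij]])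
    have T_rep: "T (\<rho> h v) = \<rho> h (T v)" for h v
    proof (rule injD[OF bij_is_inj[OF M_bij]])
      show "M (T (\<rho> h v)) = M (\<rho> h (T v))"
        using N_rep[of "fst h" "snd h" v] M_rep[of "fst h" "snd h" "T v"] by (simp add: MT)
    qed
    obtain c where c: "T = sS c" using schur[OF model T_lin T_rep] by blast
    have N: "N = sS c \<circ> M"
      using MT by (auto simp: fun_eq_iff c M_scale)
    have "\<exists>v::'s. v \<noteq> 0" using model by (simp add: heisenberg_model_def)
    then obtain v :: 's where v: "v \<noteq> 0" ..
    have "c \<noteq> 0"
    proof
      assume "c = 0"
      then have "N v = N 0" by (simp add: N)
      then show False using v injD[OF bij_is_inj[OF N_bij]] by blast
    qed
    then show "N \<in> to_PGL sS M" using N by (auto simp: to_PGL_eq)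
  next
    fix N assume "N \<in> to_PGL sS M"
    then obtain c where c: "c \<noteq> 0" "N = sS c \<circ> M" by (auto simp: to_PGL_eq)
    have "sS c \<circ> sS (1 / c) = id" "sS (1 / c) \<circ> sS c = id" using c by (auto simp: fun_eq_iff)
    then have "bij (sS c)" by (rule o_bij[rotated])
    then have "bij N" unfolding c by (rule bij_comp[OF M_bij])
    moreover have "Vector_Spaces.linear sS sS N"
      unfolding c by (rule linear_comp[OF M_lin V.linear_scale_self])
    ultimately show "N \<in> \<sigma> sS \<rho> g"
      by (simp add: \<sigma>_def intertwines_iff[OF g] c M_rep rep_scale)
  qed
qed

lemma Mp_carrier_iff:
  assumes model: "heisenberg_model absF sW \<omega> \<psi> sS \<rho>"
  shows "(g, M) \<in> carrier (Mp sW \<omega> sS \<rho>) \<longleftrightarrow> g \<in> carrier (Sp sW \<omega>) \<and>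
    Vector_Spaces.linear sS sS M \<and> bij M \<and> (\<forall>w t v. M (\<rho> (w, t) v) = \<rho> (g w, t) (M v))"
proof -
  have "(g, M) \<in> carrier (Mp sW \<omega> sS \<rho>) \<longleftrightarrow>
      g \<in> carrier (Sp sW \<omega>) \<and> M \<in> carrier (GL sS) \<and> \<sigma> sS \<rho> g = to_PGL sS M"
    by (simp add: Mp_def fibre_product_def)
  then show ?thesis
    using \<sigma>_eq_to_PGL_iff[OF model, of g M] intertwines_iff[of g sS \<rho> M] by auto
qed

lemma Mp_simps [simp]:
  "(g, M) \<otimes>\<^bsub>Mp sW \<omega> sS \<rho>\<^esub> (h, N) = (g \<circ> h, M \<circ> N)" "\<one>\<^bsub>Mp sW \<omega> sS \<rho>\<^esub> = (id, id)"
  by (simp_all add: Mp_def fibre_product_def DirProd_def)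

lemma group_Mp:
  assumes model: "heisenberg_model absF sW \<omega> \<psi> sS \<rho>"
  shows "group (Mp sW \<omega> sS \<rho>)"
proof -
  interpret heisenberg_rep sW Bs \<omega> \<psi> sS \<rho> by (rule heisenberg_rep_of_model(1)[OF model])
  note mem = Mp_carrier_iff[OF model]
  have Sp_comp: "g \<circ> h \<in> carrier (Sp sW \<omega>)"
    if "g \<in> carrier (Sp sW \<omega>)" "h \<in> carrier (Sp sW \<omega>)" for g h
    using that monoid.m_closed[OF group.is_monoid[OF group_Sp]] by (metis Sp_mult)
  have id_Sp: "id \<in> carrier (Sp sW \<omega>)"
    using monoid.one_closed[OF group.is_monoid[OF group_Sp]] by simp
  show ?thesis
  proof (rule groupI)
    fix x y assume "x \<in> carrier (Mp sW \<omega> sS \<rho>)" "y \<in> carrier (Mp sW \<omega> sS \<rho>)"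
    then show "x \<otimes>\<^bsub>Mp sW \<omega> sS \<rho>\<^esub> y \<in> carrier (Mp sW \<omega> sS \<rho>)"
      by (cases x; cases y) (simp add: mem Sp_comp linear_comp[of sS sS _ sS] bij_comp)
  next
    show "\<one>\<^bsub>Mp sW \<omega> sS \<rho>\<^esub> \<in> carrier (Mp sW \<omega> sS \<rho>)"
      using id_Sp V.linear_id by (simp add: mem)
  next
    fix x y z assume "x \<in> carrier (Mp sW \<omega> sS \<rho>)" "y \<in> carrier (Mp sW \<omega> sS \<rho>)" "z \<in> carrier (Mp sW \<omega> sS \<rho>)"
    then show "x \<otimes>\<^bsub>Mp sW \<omega> sS \<rho>\<^esub> y \<otimes>\<^bsub>Mp sW \<omega> sS \<rho>\<^esub> z =
        x \<otimes>\<^bsub>Mp sW \<omega> sS \<rho>\<^esub> (y \<otimes>\<^bsub>Mp sW \<omega> sS \<rho>\<^esub> z)"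
      by (cases x; cases y; cases z) (simp add: o_assoc)
  next
    fix x assume "x \<in> carrier (Mp sW \<omega> sS \<rho>)"
    then show "\<one>\<^bsub>Mp sW \<omega> sS \<rho>\<^esub> \<otimes>\<^bsub>Mp sW \<omega> sS \<rho>\<^esub> x = x"
      by (cases x) simp
  next
    fix x assume x: "x \<in> carrier (Mp sW \<omega> sS \<rho>)"
    obtain g M where gM: "x = (g, M)" by (cases x)
    then have g: "g \<in> carrier (Sp sW \<omega>)" "bij g" and M: "Vector_Spaces.linear sS sS M" "bij M"
      and rep: "\<And>w t v. M (\<rho> (w, t) v) = \<rho> (g w, t) (M v)"
      using x by (auto simp: mem Sp_iff)
    have "inv_into UNIV M (\<rho> (w, t) v) = \<rho> (inv_into UNIV g w, t) (inv_into UNIV M v)" for w t v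
      using rep[of "inv_into UNIV g w" t "inv_into UNIV M v"] g(2) M(2)
      by (metis bij_inv_eq_iff)
    then have "(inv_into UNIV g, inv_into UNIV M) \<in> carrier (Mp sW \<omega> sS \<rho>)"
      using g M by (simp add: mem Sp_inv_into linear_inv_into bij_imp_bij_inv)
    moreover have "(inv_into UNIV g, inv_into UNIV M) \<otimes>\<^bsub>Mp sW \<omega> sS \<rho>\<^esub> x = \<one>\<^bsub>Mp sW \<omega> sS \<rho>\<^esub>"
      using g(2) M(2) by (simp add: gM bij_is_inj)
    ultimately show "\<exists>y\<in>carrier (Mp sW \<omega> sS \<rho>). y \<otimes>\<^bsub>Mp sW \<omega> sS \<rho>\<^esub> x = \<one>\<^bsub>Mp sW \<omega> sS \<rho>\<^esub>"
      by blast
  qed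
qed

lemma i_map_in_Mp:
  assumes model: "heisenberg_model absF sW \<omega> \<psi> sS \<rho>" and "c \<noteq> 0"
  shows "i_map sS c \<in> carrier (Mp sW \<omega> sS \<rho>)"
proof -
  interpret heisenberg_rep sW Bs \<omega> \<psi> sS \<rho> by (rule heisenberg_rep_of_model(1)[OF model])
  have "sS c \<circ> sS (1 / c) = id" "sS (1 / c) \<circ> sS c = id" using assms(2) by (auto simp: fun_eq_iff)
  then have "bij (sS c)" by (rule o_bij[rotated])
  moreover have "id \<in> carrier (Sp sW \<omega>)"
    using monoid.one_closed[OF group.is_monoid[OF group_Sp]] by simp
  ultimately show ?thesis
    using V.linear_scale_self by (simp add: i_map_def Mp_carrier_iff[OF model] rep_scale)
qed

text \<open>Exactness in the middle is Schur's lemma, surjectivity is the existence of intertwiners,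
  injectivity comes from a nonzero vector, and centrality is linearity of the operators.\<close>

lemma central_extension_Mp:
  fixes sS :: "'r \<Rightarrow> 's::ab_group_add \<Rightarrow> 's"
  assumes model: "heisenberg_model absF sW \<omega> \<psi> sS \<rho>"
  shows "central_extension (mult_group TYPE('r)) (i_map sS) (Mp sW \<omega> sS \<rho>) p_map (Sp sW \<omega>)"
proof -
  interpret heisenberg_rep sW Bs \<omega> \<psi> sS \<rho> by (rule heisenberg_rep_of_model(1)[OF model])
  note mem = Mp_carrier_iff[OF model]
  have "\<exists>v::'s. v \<noteq> 0" using model by (simp add: heisenberg_model_def)
  then obtain v0 :: 's where v0: "v0 \<noteq> 0" ..
  have i_hom: "i_map sS \<in> hom (mult_group TYPE('r)) (Mp sW \<omega> sS \<rho>)"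
  proof (rule homI)
    fix c d :: 'r assume "c \<in> carrier (mult_group TYPE('r))" "d \<in> carrier (mult_group TYPE('r))"
    show "i_map sS (c \<otimes>\<^bsub>mult_group TYPE('r)\<^esub> d) = i_map sS c \<otimes>\<^bsub>Mp sW \<omega> sS \<rho>\<^esub> i_map sS d"
      by (simp add: i_map_def fun_eq_iff)
  qed (simp add: i_map_in_Mp[OF model])
  have p_hom: "p_map \<in> hom (Mp sW \<omega> sS \<rho>) (Sp sW \<omega>)"
  proof (rule homI)
    fix x y assume "x \<in> carrier (Mp sW \<omega> sS \<rho>)" "y \<in> carrier (Mp sW \<omega> sS \<rho>)"
    then show "p_map (x \<otimes>\<^bsub>Mp sW \<omega> sS \<rho>\<^esub> y) = p_map x \<otimes>\<^bsub>Sp sW \<omega>\<^esub> p_map y"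
      by (cases x; cases y) (simp add: p_map_def)
  next
    fix x assume "x \<in> carrier (Mp sW \<omega> sS \<rho>)"
    then show "p_map x \<in> carrier (Sp sW \<omega>)" by (cases x) (simp add: p_map_def mem)
  qed
  have inj: "inj_on (i_map sS) (carrier (mult_group TYPE('r)))"
  proof (rule inj_onI)
    fix c d assume "i_map sS c = i_map sS d"
    then have "sS c = sS d" by (simp add: i_map_def)
    then have "sS c v0 = sS d v0" by (rule fun_cong)
    then show "c = d" using v0 by auto
  qed
  have "x \<in> i_map sS ` carrier (mult_group TYPE('r))" if x: "x \<in> kernel (Mp sW \<omega> sS \<rho>) (Sp sW \<omega>) p_map" for x
  proof -
    obtain g M where gM: "x = (g, M)" by (cases x)
    then have g: "g = id" and M: "Vector_Spaces.linear sS sS M" "bij M"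
      and rep: "\<And>w t v. M (\<rho> (w, t) v) = \<rho> (w, t) (M v)"
      using x by (auto simp: kernel_def mem p_map_def)
    have "M (\<rho> h v) = \<rho> h (M v)" for h v using rep by (cases h) simp
    then obtain c where c: "M = sS c" using schur[OF model M(1)] by blast
    have "c \<noteq> 0"
    proof
      assume "c = 0"
      then have "M v0 = M 0" by (simp add: c)
      then show False using v0 injD[OF bij_is_inj[OF M(2)]] by blast
    qed
    then show ?thesis by (auto simp: gM g c i_map_def)
  qed
  moreover have "i_map sS c \<in> kernel (Mp sW \<omega> sS \<rho>) (Sp sW \<omega>) p_map" if "c \<noteq> 0" for c
    using i_map_in_Mp[OF model that] by (simp add: kernel_def p_map_def i_map_def)
  ultimately have "i_map sS ` carrier (mult_group TYPE('r)) = kernel (Mp sW \<omega> sS \<rho>) (Sp sW \<omega>) p_map"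
    by auto
  moreover have "g \<in> p_map ` carrier (Mp sW \<omega> sS \<rho>)" if g: "g \<in> carrier (Sp sW \<omega>)" for g
  proof -
    obtain M where "intertwines sS \<rho> g M" using intertwiner_exists[OF model g] by blast
    then have "(g, M) \<in> carrier (Mp sW \<omega> sS \<rho>)" using g by (simp add: mem intertwines_iff[OF g])
    then show ?thesis by (intro image_eqI[of _ _ "(g, M)"]) (simp_all add: p_map_def)
  qed
  then have "p_map ` carrier (Mp sW \<omega> sS \<rho>) = carrier (Sp sW \<omega>)"
    using p_hom by (auto simp: hom_def)
  moreover have "i_map sS c \<otimes>\<^bsub>Mp sW \<omega> sS \<rho>\<^esub> x = x \<otimes>\<^bsub>Mp sW \<omega> sS \<rho>\<^esub> i_map sS c"
    if "x \<in> carrier (Mp sW \<omega> sS \<rho>)" for c x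
    using that by (cases x) (auto simp: i_map_def mem Vector_Spaces.linear_iff fun_eq_iff)
  ultimately show ?thesis
    unfolding central_extension_def
    using comm_group_mult_group comm_group.axioms(2) group_Mp[OF model] group_Sp i_hom p_hom inj by blast
qed

section \<open>Comparison of two models by conjugation\<close>

lemma conj_map_in_Mp:
  assumes S: "heisenberg_model absF sW \<omega> \<psi> sS \<rho>" and S': "heisenberg_model absF sW \<omega> \<psi> sS' \<rho>'"
    and \<phi>: "rep_iso sS \<rho> sS' \<rho>' \<phi>" and gM: "(g, M) \<in> carrier (Mp sW \<omega> sS \<rho>)"
  shows "(g, \<phi> \<circ> M \<circ> inv_into UNIV \<phi>) \<in> carrier (Mp sW \<omega> sS' \<rho>')"
proof -
  have lin: "Vector_Spaces.linear sS sS' \<phi>" and bij: "bij \<phi>" and rep: "\<And>h v. \<phi> (\<rho> h v) = \<rho>' h (\<phi> v)"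
    using \<phi> by (auto simp: rep_iso_def fun_eq_iff)
  have inv_rep: "inv_into UNIV \<phi> (\<rho>' h v) = \<rho> h (inv_into UNIV \<phi> v)" for h v
    using rep bij by (metis bij_inv_eq_iff)
  show ?thesis
    using gM bij linear_comp[OF linear_comp[OF linear_inv_into[OF lin bij]] lin]
    by (auto simp: Mp_carrier_iff[OF S] Mp_carrier_iff[OF S'] inv_rep rep bij_comp bij_imp_bij_inv o_assoc)
qed

lemma rep_iso_inv:
  assumes "rep_iso sS \<rho> sS' \<rho>' \<phi>"
  shows "rep_iso sS' \<rho>' sS \<rho> (inv_into UNIV \<phi>)"
proof -
  have lin: "Vector_Spaces.linear sS sS' \<phi>" and bij: "bij \<phi>" and rep: "\<And>h v. \<phi> (\<rho> h v) = \<rho>' h (\<phi> v)"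
    using assms by (auto simp: rep_iso_def fun_eq_iff)
  have "inv_into UNIV \<phi> (\<rho>' h v) = \<rho> h (inv_into UNIV \<phi> v)" for h v
    using rep bij by (metis bij_inv_eq_iff)
  then show ?thesis
    using linear_inv_into[OF lin bij] bij by (simp add: rep_iso_def bij_imp_bij_inv fun_eq_iff)
qed

text \<open>Conjugation by the inverse of \<open>\<phi>\<close> is the inverse map; linearity of
  \<open>\<phi>\<close> preserves scalars, and the component in \<open>Sp\<close> is
  untouched.\<close>

lemma Mp_iso_conj_map:
  assumes S: "heisenberg_model absF sW \<omega> \<psi> sS \<rho>" and S': "heisenberg_model absF sW \<omega> \<psi> sS' \<rho>'"
    and \<phi>: "rep_iso sS \<rho> sS' \<rho>' \<phi>"
  shows "Mp_iso sW \<omega> sS \<rho> sS' \<rho>' (conj_map sW \<omega> sS \<rho> \<phi>)"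
proof -
  let ?f = "conj_map sW \<omega> sS \<rho> \<phi>"
  have lin: "Vector_Spaces.linear sS sS' \<phi>" and bij: "bij \<phi>"
    using \<phi> by (auto simp: rep_iso_def)
  have inv1: "\<phi> (inv_into UNIV \<phi> y) = y" and inv2: "inv_into UNIV \<phi> (\<phi> x) = x" for x y
    using bij by (simp_all add: bij_is_surj surj_f_inv_f bij_is_inj)
  have f: "?f (g, M) = (g, \<phi> \<circ> M \<circ> inv_into UNIV \<phi>)" if "(g, M) \<in> carrier (Mp sW \<omega> sS \<rho>)" for g M
    using that by (simp add: conj_map_def)
  interpret Mp: group "Mp sW \<omega> sS \<rho>" by (rule group_Mp[OF S])
  have "?f \<in> hom (Mp sW \<omega> sS \<rho>) (Mp sW \<omega> sS' \<rho>')"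
  proof (rule homI)
    fix x assume "x \<in> carrier (Mp sW \<omega> sS \<rho>)"
    then show "?f x \<in> carrier (Mp sW \<omega> sS' \<rho>')"
      by (cases x) (simp add: f conj_map_in_Mp[OF S S' \<phi>])
  next
    fix x y assume xy: "x \<in> carrier (Mp sW \<omega> sS \<rho>)" "y \<in> carrier (Mp sW \<omega> sS \<rho>)"
    obtain g M h N where gM: "x = (g, M)" "y = (h, N)" by (cases x; cases y)
    have "(g \<circ> h, M \<circ> N) \<in> carrier (Mp sW \<omega> sS \<rho>)" using Mp.m_closed[OF xy] by (simp add: gM)
    then show "?f (x \<otimes>\<^bsub>Mp sW \<omega> sS \<rho>\<^esub> y) = ?f x \<otimes>\<^bsub>Mp sW \<omega> sS' \<rho>'\<^esub> ?f y"
      using xy by (simp add: gM f fun_eq_iff inv2)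
  qed
  moreover have "bij_betw ?f (carrier (Mp sW \<omega> sS \<rho>)) (carrier (Mp sW \<omega> sS' \<rho>'))"
  proof (rule bij_betw_byWitness[where f' = "\<lambda>(g, M). (g, inv_into UNIV \<phi> \<circ> M \<circ> \<phi>)"])
    show "\<forall>x\<in>carrier (Mp sW \<omega> sS \<rho>). (\<lambda>(g, M). (g, inv_into UNIV \<phi> \<circ> M \<circ> \<phi>)) (?f x) = x"
      by (auto simp: f fun_eq_iff inv2)
    have back_mem: "(g, inv_into UNIV \<phi> \<circ> M \<circ> \<phi>) \<in> carrier (Mp sW \<omega> sS \<rho>)"
      if "(g, M) \<in> carrier (Mp sW \<omega> sS' \<rho>')" for g M
      using conj_map_in_Mp[OF S' S rep_iso_inv[OF \<phi>] that] bij by (simp add: inv_inv_eq)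
    then show "(\<lambda>(g, M). (g, inv_into UNIV \<phi> \<circ> M \<circ> \<phi>)) ` carrier (Mp sW \<omega> sS' \<rho>') \<subseteq> carrier (Mp sW \<omega> sS \<rho>)"
      by auto
    show "\<forall>x\<in>carrier (Mp sW \<omega> sS' \<rho>'). ?f ((\<lambda>(g, M). (g, inv_into UNIV \<phi> \<circ> M \<circ> \<phi>)) x) = x"
      by (auto simp: f back_mem fun_eq_iff inv1)
    show "?f ` carrier (Mp sW \<omega> sS \<rho>) \<subseteq> carrier (Mp sW \<omega> sS' \<rho>')"
      by (auto simp: f conj_map_in_Mp[OF S S' \<phi>])
  qed
  moreover have "?f (i_map sS c) = i_map sS' c" if "c \<noteq> 0" for c
  proof -
    have "?f (i_map sS c) = (id, \<phi> \<circ> sS c \<circ> inv_into UNIV \<phi>)"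
      using i_map_in_Mp[OF S that] by (simp add: i_map_def f)
    then show ?thesis using lin by (simp add: i_map_def fun_eq_iff Vector_Spaces.linear_iff inv1)
  qed
  moreover have "p_map (?f x) = p_map x" if "x \<in> carrier (Mp sW \<omega> sS \<rho>)" for x
    using that by (cases x) (simp add: f p_map_def)
  ultimately show ?thesis by (simp add: Mp_iso_def central_extension_iso_def iso_def)
qed

text \<open>By Schur's lemma two choices differ by a scalar, which commutes with every linear
  \<open>M\<close> and cancels in the conjugation.\<close>

lemma conj_map_independent:
  assumes S: "heisenberg_model absF sW \<omega> \<psi> sS \<rho>"
    and \<phi>: "rep_iso sS \<rho> sS' \<rho>' \<phi>" and \<phi>': "rep_iso sS \<rho> sS' \<rho>' \<phi>'"
  shows "conj_map sW \<omega> sS \<rho> \<phi> = conj_map sW \<omega> sS \<rho> \<phi>'"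
proof -
  have lin: "Vector_Spaces.linear sS sS' \<phi>" and bij: "bij \<phi>" and rep: "\<And>h v. \<phi> (\<rho> h v) = \<rho>' h (\<phi> v)"
    using \<phi> by (auto simp: rep_iso_def fun_eq_iff)
  have lin': "Vector_Spaces.linear sS sS' \<phi>'" and bij': "bij \<phi>'" and rep': "\<And>h v. \<phi>' (\<rho> h v) = \<rho>' h (\<phi>' v)"
    using \<phi>' by (auto simp: rep_iso_def fun_eq_iff)
  define T where "T = inv_into UNIV \<phi>' \<circ> \<phi>"
  have \<phi>'T: "\<phi>' (T v) = \<phi> v" for v using bij' by (simp add: T_def bij_is_surj surj_f_inv_f)
  have T_lin: "Vector_Spaces.linear sS sS T"
    unfolding T_def by (rule linear_comp[OF lin linear_inv_into[OF lin' bij']])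
  have T_rep: "T (\<rho> h v) = \<rho> h (T v)" for h v
    by (rule injD[OF bij_is_inj[OF bij']]) (simp add: \<phi>'T rep rep')
  obtain c where c: "T = sS c" using schur[OF S T_lin T_rep] by blast
  have "\<phi> (M (inv_into UNIV \<phi> y)) = \<phi>' (M (inv_into UNIV \<phi>' y))"
    if M: "Vector_Spaces.linear sS sS M" for M y
  proof -
    define x where "x = inv_into UNIV \<phi> y"
    have y: "y = \<phi>' (sS c x)" using bij \<phi>'T by (simp add: x_def c[symmetric] bij_is_surj surj_f_inv_f)
    have "\<phi>' (M (inv_into UNIV \<phi>' y)) = \<phi>' (M (sS c x))" using bij' by (simp add: y bij_is_inj)
    also have "\<dots> = \<phi>' (T (M x))" using M by (simp add: c Vector_Spaces.linear_iff)
    finally show ?thesis by (simp add: \<phi>'T x_def)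
  qed
  then show ?thesis
    unfolding conj_map_def by (intro restrict_ext) (auto simp: Mp_carrier_iff[OF S] fun_eq_iff)
qed

end

theorem proposition3p2:
  fixes absF :: "'f::field \<Rightarrow> real" and p :: nat
    and sW :: "'f \<Rightarrow> 'w::ab_group_add \<Rightarrow> 'w" and \<omega> :: "'w \<Rightarrow> 'w \<Rightarrow> 'f"
    and \<psi> :: "'f \<Rightarrow> 'r::field"
    and sS :: "'r \<Rightarrow> 's::ab_group_add \<Rightarrow> 's" and \<rho> :: "'w \<times> 'f \<Rightarrow> 's \<Rightarrow> 's"
  assumes "base_field absF p"
    and "symplectic_space sW \<omega>"
    and "smooth_character absF \<psi>" and "\<exists>x. \<psi> x \<noteq> 1"
    and "heisenberg_model absF sW \<omega> \<psi> sS \<rho>"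
  shows "central_extension (mult_group TYPE('r)) (i_map sS) (Mp sW \<omega> sS \<rho>) p_map (Sp sW \<omega>)
    \<and> (\<forall>(sS' :: 'r \<Rightarrow> 't::ab_group_add \<Rightarrow> 't) (\<rho>' :: 'w \<times> 'f \<Rightarrow> 't \<Rightarrow> 't).
        heisenberg_model absF sW \<omega> \<psi> sS' \<rho>' \<longrightarrow>
          (\<exists>\<phi>. rep_iso sS \<rho> sS' \<rho>' \<phi>)
        \<and> (\<forall>\<phi>. rep_iso sS \<rho> sS' \<rho>' \<phi> \<longrightarrow>
              Mp_iso sW \<omega> sS \<rho> sS' \<rho>' (conj_map sW \<omega> sS \<rho> \<phi>)
            \<and> conj_map sW \<omega> sS \<rho> \<phi> = \<Phi> sW \<omega> sS \<rho> sS' \<rho>')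
        \<and> (\<not> (card (UNIV :: 'f set) = 3 \<and> vector_space.dim sW (UNIV :: 'w set) = 2) \<longrightarrow>
              (\<exists>!f. f \<in> extensional (carrier (Mp sW \<omega> sS \<rho>)) \<and> Mp_iso sW \<omega> sS \<rho> sS' \<rho>' f)
            \<and> Mp_iso sW \<omega> sS \<rho> sS' \<rho>' (\<Phi> sW \<omega> sS \<rho> sS' \<rho>')))"
proof -
  let ?E = "Mp sW \<omega> sS \<rho>"
  obtain Bs where "finite_dimensional_vector_space sW Bs"
    using assms(2) by (auto simp: symplectic_space_def)
  moreover have "symplectic_axioms sW \<omega>"
    using assms(2) by (simp add: symplectic_space_def symplectic_axioms_def)
  ultimately have "symplectic sW Bs \<omega>" by (rule symplectic.intro)
  moreover have "additive_character \<psi>"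
    using assms(3) by (simp add: smooth_character_def additive_character_def)
  moreover have two: "(2 :: 'f) \<noteq> 0"
    using assms(1) by (rule base_field.char_neq_2)
  moreover have "openin (field_topology absF) {x. \<psi> x = 1}"
    using assms(3) by (simp add: smooth_character_def)
  ultimately interpret heisenberg_base_field sW Bs \<omega> \<psi> absF p
    using assms(1,4)
    by (intro heisenberg_base_field.intro heisenberg_form.intro heisenberg_form_axioms.intro
        smooth_character_field.intro smooth_character_field_axioms.intro)
  note S = assms(5)
  show ?thesis
  proof (intro conjI allI impI)
    show "central_extension (mult_group TYPE('r)) (i_map sS) ?E p_map (Sp sW \<omega>)"
      by (rule central_extension_Mp[OF S])
  next
    fix sS' :: "'r \<Rightarrow> 't \<Rightarrow> 't" and \<rho>' :: "'w \<times> 'f \<Rightarrow> 't \<Rightarrow> 't"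
    assume S': "heisenberg_model absF sW \<omega> \<psi> sS' \<rho>'"
    show ex: "\<exists>\<phi>. rep_iso sS \<rho> sS' \<rho>' \<phi>" by (rule stone_von_neumann[OF S S'])
    \<comment> \<open>The Stone-von Neumann theorem makes the choice inside \<open>\<Phi>\<close> a
      genuine isomorphism.\<close>
    then have some: "rep_iso sS \<rho> sS' \<rho>' (SOME \<phi>. rep_iso sS \<rho> sS' \<rho>' \<phi>)" by (rule someI_ex)
    show \<Phi>_iso: "Mp_iso sW \<omega> sS \<rho> sS' \<rho>' (\<Phi> sW \<omega> sS \<rho> sS' \<rho>')"
      unfolding \<Phi>_def by (rule Mp_iso_conj_map[OF S S' some])
    show "Mp_iso sW \<omega> sS \<rho> sS' \<rho>' (conj_map sW \<omega> sS \<rho> \<phi>)" if "rep_iso sS \<rho> sS' \<rho>' \<phi>" for \<phi>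
      by (rule Mp_iso_conj_map[OF S S' that])
    show "conj_map sW \<omega> sS \<rho> \<phi> = \<Phi> sW \<omega> sS \<rho> sS' \<rho>'" if "rep_iso sS \<rho> sS' \<rho>' \<phi>" for \<phi>
      unfolding \<Phi>_def by (rule conj_map_independent[OF S that some])
    assume nonexceptional: "\<not> (card (UNIV :: 'f set) = 3 \<and> vector_space.dim sW (UNIV :: 'w set) = 2)"
    \<comment> \<open>This is where the excluded case of three elements and dimension 2
      enters.\<close>
    have trivial: "\<eta> g = \<one>\<^bsub>mult_group TYPE('r)\<^esub>"
      if "\<eta> \<in> hom (Sp sW \<omega>) (mult_group TYPE('r))" "g \<in> carrier (Sp sW \<omega>)" for \<eta> g
      by (rule hom_Sp_trivial[OF comm_group_mult_group that(1) nonexceptional two that(2)])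
    show "\<exists>!f. f \<in> extensional (carrier ?E) \<and> Mp_iso sW \<omega> sS \<rho> sS' \<rho>' f"
    proof (rule ex1I)
      show "\<Phi> sW \<omega> sS \<rho> sS' \<rho>' \<in> extensional (carrier ?E) \<and> Mp_iso sW \<omega> sS \<rho> sS' \<rho>' (\<Phi> sW \<omega> sS \<rho> sS' \<rho>')"
        using \<Phi>_iso by (simp add: \<Phi>_def conj_map_def)
    next
      fix f assume f: "f \<in> extensional (carrier ?E) \<and> Mp_iso sW \<omega> sS \<rho> sS' \<rho>' f"
      have "f x = \<Phi> sW \<omega> sS \<rho> sS' \<rho>' x" if "x \<in> carrier ?E" for x
      proof (rule central_extension_iso_unique[OF central_extension_Mp[OF S] central_extension_Mp[OF S'] _ _ _ that])
        show "\<eta> g = \<one>\<^bsub>mult_group TYPE('r)\<^esub>"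
          if "\<eta> \<in> hom (Sp sW \<omega>) (mult_group TYPE('r))" "g \<in> carrier (Sp sW \<omega>)" for \<eta> g
          using that by (rule trivial)
      qed (use f \<Phi>_iso in \<open>simp_all add: Mp_iso_def\<close>)
      \<comment> \<open>Both maps are \<open>undefined\<close> off the carrier, so agreement on it
        gives equality.\<close>
      then show "f = \<Phi> sW \<omega> sS \<rho> sS' \<rho>'"
        using f by (intro extensionalityI[of _ "carrier ?E"]) (simp_all add: \<Phi>_def conj_map_def)
    qed
  qed
qed

end
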